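(* Let $G$ be a $2$-edge-connected graph and $\emptyset\subsetneq S\subsetneq V(G)$ such that $\delta(S)$ is an inclusion-wise minimal cut with $|\delta(S)|\ge 3$. Let $e\in\delta(S)$. Then the asymmetric cut inequality $$x_e - x(\delta(S)\setminus\{e\})\le 0$$ defines a facet of $\mathrm{TECSP}(G)$ if and only if every bridge of $G[S]$ and every bridge of $G[V(G)\setminus S]$ lies in a common coparallel class of $G$ with some edge of $\delta(S)$.
   Context: All graphs are finite, simple and undirected. For $\emptyset\subsetneq S\subsetneq V(G)$, $\delta(S)$ is the set of edges with exactly one endpoint in $S$ (a cut); $G[S]$ is the induced subgraph on $S$. An edge $e$ is a bridge of a graph if its removal increases the number of connected components. A graph is $2$-edge-connected if it is connected and has no bridges; the empty graph and a single vertex are $2$-edge-connected. For $F\subseteq E(G)$, $x(F)=\sum_{f\in F}x_f$. $\chi^H\in\{0,1\}^{E(G)}$ is the incidence vector of $E(H)$, and $\mathrm{TECSP}(G)=\mathrm{conv}\{\chi^H : H\subseteq G\text{ is }2\text{-edge-connected}\}\subseteq\mathbb{R}^{E(G)}$. Two distinct edges $e,f$ of $G$ are coparallel if $\{e,f\}$ is an inclusion-wise minimal cut of $G$; a coparallel class is an inclusion-wise maximal set of non-bridge edges of $G$ any two distinct elements of which are coparallel (a non-bridge edge in no $2$-cut forms a singleton class). A facet is a face of dimension $\dim(\mathrm{TECSP}(G))-1$. *)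

theory Defs
  imports "HOL-Analysis.Analysis"
begin

text \<open>Finite simple undirected graphs: vertex set V (inside a finite type 'v),
  edge set E of 2-element subsets of V.\<close>

definition simple_graph :: "'v set \<Rightarrow> 'v set set \<Rightarrow> bool" where
  "simple_graph V E \<longleftrightarrow> finite V \<and> (\<forall>e\<in>E. e \<subseteq> V \<and> card e = 2)"

definition adj :: "'v set set \<Rightarrow> ('v \<times> 'v) set" where
  "adj E = {(u, v). {u, v} \<in> E}"

text \<open>Same connected component (relation on V).\<close>
definition conn_rel :: "'v set \<Rightarrow> 'v set set \<Rightarrow> ('v \<times> 'v) set" where
  "conn_rel V E = {(u, v). u \<in> V \<and> v \<in> V \<and> (u, v) \<in> (adj E)\<^sup>*}"

definition num_components :: "'v set \<Rightarrow> 'v set set \<Rightarrow> nat" where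
  "num_components V E = card (V // conn_rel V E)"

definition connected_graph :: "'v set \<Rightarrow> 'v set set \<Rightarrow> bool" where
  "connected_graph V E \<longleftrightarrow> (\<forall>u\<in>V. \<forall>v\<in>V. (u, v) \<in> (adj E)\<^sup>*)"

definition is_bridge :: "'v set \<Rightarrow> 'v set set \<Rightarrow> 'v set \<Rightarrow> bool" where
  "is_bridge V E e \<longleftrightarrow> e \<in> E \<and> num_components V (E - {e}) > num_components V E"

text \<open>2-edge-connected: connected and bridgeless (empty graph and single vertex included).\<close>
definition two_edge_connected :: "'v set \<Rightarrow> 'v set set \<Rightarrow> bool" where
  "two_edge_connected V E \<longleftrightarrow> connected_graph V E \<and> (\<forall>e\<in>E. \<not> is_bridge V E e)"

definition delta :: "'v set set \<Rightarrow> 'v set \<Rightarrow> 'v set set" where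
  "delta E S = {e \<in> E. card (e \<inter> S) = 1}"

definition induced_edges :: "'v set set \<Rightarrow> 'v set \<Rightarrow> 'v set set" where
  "induced_edges E S = {e \<in> E. e \<subseteq> S}"

definition is_cut :: "'v set \<Rightarrow> 'v set set \<Rightarrow> 'v set set \<Rightarrow> bool" where
  "is_cut V E F \<longleftrightarrow> (\<exists>S. {} \<subset> S \<and> S \<subset> V \<and> F = delta E S)"

definition minimal_cut :: "'v set \<Rightarrow> 'v set set \<Rightarrow> 'v set set \<Rightarrow> bool" where
  "minimal_cut V E F \<longleftrightarrow> is_cut V E F \<and> (\<forall>F'. is_cut V E F' \<and> F' \<subseteq> F \<longrightarrow> F' = F)"

definition coparallel :: "'v set \<Rightarrow> 'v set set \<Rightarrow> 'v set \<Rightarrow> 'v set \<Rightarrow> bool" where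
  "coparallel V E e f \<longleftrightarrow> e \<noteq> f \<and> e \<in> E \<and> f \<in> E \<and> minimal_cut V E {e, f}"

definition copar_set :: "'v set \<Rightarrow> 'v set set \<Rightarrow> 'v set set \<Rightarrow> bool" where
  "copar_set V E C \<longleftrightarrow> C \<subseteq> E \<and> (\<forall>e\<in>C. \<not> is_bridge V E e)
     \<and> (\<forall>e\<in>C. \<forall>f\<in>C. e \<noteq> f \<longrightarrow> coparallel V E e f)"

text \<open>Coparallel class: inclusion-wise maximal (nonempty) set of non-bridge edges,
  pairwise coparallel.\<close>
definition coparallel_class :: "'v set \<Rightarrow> 'v set set \<Rightarrow> 'v set set \<Rightarrow> bool" where
  "coparallel_class V E C \<longleftrightarrow> C \<noteq> {} \<and> copar_set V E C \<and>
     (\<forall>C'. copar_set V E C' \<and> C \<subseteq> C' \<longrightarrow> C' = C)"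

text \<open>Vectors in R^{E(G)} are represented in real^('v set); incidence vectors vanish
  outside E(G), so all relevant points lie in the coordinate subspace of E(G).\<close>
definition incidence :: "'v::finite set set \<Rightarrow> real ^ ('v set)" where
  "incidence F = (\<chi> i. if i \<in> F then 1 else 0)"

definition TECSP :: "'v::finite set \<Rightarrow> 'v set set \<Rightarrow> (real ^ ('v set)) set" where
  "TECSP V E = convex hull {incidence F | W F. W \<subseteq> V \<and> F \<subseteq> E \<and> (\<forall>e\<in>F. e \<subseteq> W)
                                        \<and> two_edge_connected W F}"

text \<open>An inequality a x \<le> b defines a facet of P: it is valid for P and
  the face P \<inter> {a x = b} is a facet of P.\<close>
definition defines_facet :: "(real ^ 'n) set \<Rightarrow> (real ^ 'n \<Rightarrow> real) \<Rightarrow> real \<Rightarrow> bool" where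
  "defines_facet P a b \<longleftrightarrow> (\<forall>x\<in>P. a x \<le> b) \<and> (P \<inter> {x. a x = b}) facet_of P"

end

theory Submission
  imports Defs
begin

text \<open>All graph arguments are made in the cut space: \<open>\<delta>(A \<triangle> B) = \<delta>(A) \<triangle> \<delta>(B)\<close>, and an edge of a
  subgraph \<open>X\<close> is a bridge iff it is the only edge of \<open>X\<close> in some cut.

  Sufficiency. The polytope lies in the span of the incidence vectors of the coparallel classes, so it
  suffices that, modulo the span of the face, each of them is a multiple of the class of \<open>e\<close>.
  If \<open>X\<close> contains at most the edges \<open>e, f\<close> of the cut, then every 2-edge-connected subgraph of \<open>X\<close> lies on the
  face; hence the span contains the vector of the bridgeless part of \<open>X\<close> and, comparing \<open>X\<close> with \<open>X - d\<close>, of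
  the series class of \<open>d\<close> in \<open>X\<close>. For \<open>d = e\<close> and \<open>X\<close> missing only the other cut edges, this series class is
  the union of the classes of \<open>e\<close> and \<open>f\<close>. The class of a non-bridge \<open>d\<close> of \<open>G[S]\<close> is the series class of
  \<open>d\<close> in \<open>G[S]\<close> minus a union of a laminar family of differences of series classes.

  Necessity. A bridge of \<open>G[S]\<close> not coparallel to a cut edge splits the inequality into a sum of two valid
  inequalities, one of which defines a strictly larger proper face.\<close>

subsection \<open>Cuts, bridges and components\<close>

text \<open>The non-bridges of \<open>X\<close>, phrased by cuts so that no vertex set has to be
  carried along.\<close>

definition bridgeless_part :: "'v set set \<Rightarrow> 'v set set" where
  "bridgeless_part X = {b \<in> X. \<forall>T. delta X T \<noteq> {b}}"

lemma card_Int_sym_diff_eq_1_iff: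
  assumes "card b = 2"
  shows "card (b \<inter> sym_diff A B) = 1 \<longleftrightarrow> (card (b \<inter> A) = 1) \<noteq> (card (b \<inter> B) = 1)"
proof -
  obtain p q where b: "b = {p, q}" "p \<noteq> q"
    using assms by (auto simp: card_2_iff)
  have "card ({p, q} \<inter> C) = 1 \<longleftrightarrow> (p \<in> C) \<noteq> (q \<in> C)" for C
    using b(2) by (cases "p \<in> C"; cases "q \<in> C") auto
  then show ?thesis
    unfolding b(1) by auto
qed

lemma mem_delta_sym_diff_iff:
  assumes "\<And>b. b \<in> E \<Longrightarrow> card b = 2"
  shows "b \<in> delta E (sym_diff A B) \<longleftrightarrow> b \<in> E \<and> (b \<in> delta E A) \<noteq> (b \<in> delta E B)"
  using card_Int_sym_diff_eq_1_iff[of b A B] assms[of b] unfolding delta_def by blast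

lemma delta_subset: "delta E T \<subseteq> E"
  by (auto simp: delta_def)

lemma delta_restrict: "X \<subseteq> E \<Longrightarrow> delta X T = X \<inter> delta E T"
  by (auto simp: delta_def)

lemma delta_pair_iff:
  assumes "p \<noteq> q"
  shows "{p, q} \<in> delta E T \<longleftrightarrow> {p, q} \<in> E \<and> (p \<in> T) \<noteq> (q \<in> T)"
  using assms by (cases "p \<in> T"; cases "q \<in> T") (auto simp: delta_def)

section \<open>Reachability, components and bridges in terms of cuts\<close>

lemma adj_rtrancl_closed:
  assumes "\<And>b. b \<in> F \<Longrightarrow> card b = 2" "delta F T = {}" "(u, v) \<in> (adj F)\<^sup>*" "u \<in> T"
  shows "v \<in> T"
  using assms(3,4)
proof (induction rule: rtrancl_induct)
  case (step y z)
  then have "{y, z} \<in> F" "y \<in> T"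
    by (auto simp: adj_def)
  moreover have "y \<noteq> z"
    using assms(1)[OF \<open>{y, z} \<in> F\<close>] by (metis card_2_iff doubleton_eq_iff)
  ultimately show ?case
    using delta_pair_iff[of y z F T] assms(2) by auto
qed

lemma delta_reachable:
  assumes "\<And>b. b \<in> F \<Longrightarrow> card b = 2"
  shows "delta F ((adj F)\<^sup>* `` {p}) = {}"
proof -
  have False if b_cut: "b \<in> delta F ((adj F)\<^sup>* `` {p})" for b
  proof -
    obtain y z where b: "b = {y, z}" "y \<noteq> z"
      using assms[of b] b_cut by (auto simp: card_2_iff delta_def)
    then have "{y, z} \<in> F" and "(y \<in> (adj F)\<^sup>* `` {p}) \<noteq> (z \<in> (adj F)\<^sup>* `` {p})"
      using b_cut delta_pair_iff[of y z F] by simp_all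
    moreover have "(y, z) \<in> adj F" "(z, y) \<in> adj F"
      using \<open>{y, z} \<in> F\<close> by (auto simp: adj_def insert_commute)
    then have "(p, y) \<in> (adj F)\<^sup>* \<longleftrightarrow> (p, z) \<in> (adj F)\<^sup>*"
      by (meson rtrancl_into_rtrancl)
    ultimately show False
      by simp
  qed
  then show ?thesis by auto
qed

lemma sym_adj_rtrancl: "sym ((adj F)\<^sup>*)"
  by (intro sym_rtrancl) (auto simp: sym_def adj_def insert_commute)

lemma equiv_conn_rel: "equiv W (conn_rel W F)"
  using sym_adj_rtrancl[of F]
  by (auto simp: equiv_def conn_rel_def refl_on_def sym_def trans_def intro: rtrancl_trans)

text \<open>Taking images under \<open>R\<close> maps the classes of \<open>R'\<close> onto those of
  \<open>R\<close>. It stays onto when the class of \<open>q\<close> is dropped, since the class of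
  \<open>p\<close> has the same image.\<close>

lemma card_quotient_less:
  assumes "finite A" "equiv A R" "equiv A R'" "R' \<subseteq> R" "(p, q) \<in> R" "(p, q) \<notin> R'"
  shows "card (A // R) < card (A // R')"
proof -
  have pq: "p \<in> A" "q \<in> A"
    using assms(2,5) by (auto simp: equiv_def refl_on_def)
  have fin: "finite (A // R')"
    using assms(1,3) by (metis finite_quotient equiv_type)
  let ?Q = "A // R' - {R' `` {q}}"
  have im: "R `` (R' `` {x}) = R `` {x}" if "x \<in> A" for x
  proof
    show "R `` (R' `` {x}) \<subseteq> R `` {x}"
      using assms(2,4) by (auto simp: equiv_def dest: transD)
    have "x \<in> R' `` {x}"
      using assms(3) that by (rule equiv_class_self)
    then show "R `` {x} \<subseteq> R `` (R' `` {x})"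
      by auto
  qed
  have "R `` {q} = R `` {p}"
    using assms(2,5) by (metis equiv_class_eq)
  moreover have "R' `` {p} \<noteq> R' `` {q}"
    using assms(3,6) pq by (metis eq_equiv_class)
  ultimately have "A // R \<subseteq> (\<lambda>C. R `` C) ` ?Q"
  proof -
    have "R `` {x} \<in> (\<lambda>C. R `` C) ` ?Q" if x: "x \<in> A" for x
    proof (cases "R' `` {x} = R' `` {q}")
      case True
      then have "R `` {x} = R `` (R' `` {p})"
        using im[OF x] im[OF pq(1)] im[OF pq(2)] \<open>R `` {q} = R `` {p}\<close> by metis
      moreover have "R' `` {p} \<in> ?Q"
        using \<open>R' `` {p} \<noteq> R' `` {q}\<close> quotientI[OF pq(1), of R'] by simp
      ultimately show ?thesis
        by (rule image_eqI)
    next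
      case False
      then have "R' `` {x} \<in> ?Q"
        using quotientI[OF x, of R'] by simp
      then show ?thesis
        using im[OF x] by (metis imageI)
    qed
    then show ?thesis
      by (smt (verit) quotientE subsetI)
  qed
  then have "card (A // R) \<le> card ?Q"
    using fin by (meson card_image_le card_mono finite_Diff finite_imageI order_trans)
  also have "\<dots> < card (A // R')"
    using fin pq(2) by (intro psubset_card_mono) (auto intro: quotientI)
  finally show ?thesis .
qed

text \<open>For a bridge \<open>b\<close>, the set reachable from one end without \<open>b\<close>
  has the cut \<open>{b}\<close>; otherwise deleting \<open>b\<close> would not change reachability.
  Conversely, a set with the cut \<open>{b}\<close> has an empty cut in \<open>F - {b}\<close>,
  which keeps the ends of \<open>b\<close> apart.\<close>

lemma is_bridge_iff_delta:
  assumes "finite W" and F: "\<And>b. b \<in> F \<Longrightarrow> b \<subseteq> W \<and> card b = 2"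
  shows "is_bridge W F b \<longleftrightarrow> (\<exists>T. delta F T = {b})"
proof
  assume br: "is_bridge W F b"
  then have "b \<in> F" by (simp add: is_bridge_def)
  then obtain p q where b: "b = {p, q}" "p \<noteq> q"
    using F by (metis card_2_iff)
  let ?F = "F - {b}" and ?T = "(adj (F - {b}))\<^sup>* `` {p}"
  have F': "card c = 2" if "c \<in> ?F" for c
    using F that by auto
  have "delta F ?T \<subseteq> {b}"
    using delta_reachable[OF F', of ?F p] delta_restrict[of ?F F ?T] delta_subset[of F ?T] by blast
  moreover have "q \<notin> ?T"
  proof
    assume "q \<in> ?T"
    then have "(p, q) \<in> (adj ?F)\<^sup>*" by simp
    moreover from this have "(q, p) \<in> (adj ?F)\<^sup>*"
      using sym_adj_rtrancl by (metis symD)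
    moreover have "adj F \<subseteq> adj ?F \<union> {(p, q), (q, p)}"
      unfolding adj_def b by (auto simp: doubleton_eq_iff)
    ultimately have "adj F \<subseteq> (adj ?F)\<^sup>*" by auto
    moreover have "adj ?F \<subseteq> adj F" by (auto simp: adj_def)
    ultimately have "(adj F)\<^sup>* = (adj ?F)\<^sup>*"
      by (metis rtrancl_subset)
    then show False
      using br by (simp add: is_bridge_def num_components_def conn_rel_def)
  qed
  then have "b \<in> delta F ?T"
    using \<open>b \<in> F\<close> b delta_pair_iff[of p q F ?T] by auto
  ultimately show "\<exists>T. delta F T = {b}" by blast
next
  assume "\<exists>T. delta F T = {b}"
  then obtain T where T: "delta F T = {b}" ..
  then have "b \<in> F" using delta_subset by blast
  then obtain p q where b: "b = {p, q}" "p \<noteq> q"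
    using F by (metis card_2_iff)
  let ?F = "F - {b}"
  have "(p, q) \<notin> (adj ?F)\<^sup>*" if "delta F U = {b}" "p \<in> U" "q \<notin> U" for U
  proof -
    have "delta ?F U = {}" using that delta_restrict[of ?F F U] by auto
    then show ?thesis using adj_rtrancl_closed[of ?F U p q] that F by auto
  qed
  \<comment> \<open>It is unknown which end of \<open>b\<close> lies in \<open>T\<close>, so the
    complement must be available too.\<close>
  moreover have "delta F (- T) = {b}"
  proof -
    have "c \<in> F \<Longrightarrow> c \<in> delta F (- T) \<longleftrightarrow> c \<in> delta F T" for c
      using F[of c] delta_pair_iff[of _ _ F] by (metis Compl_iff card_2_iff)
    then show ?thesis using T delta_subset by blast
  qed
  moreover have "(p \<in> T) \<noteq> (q \<in> T)"
    using T b(1) delta_pair_iff[OF b(2), of F T] by auto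
  ultimately have "(p, q) \<notin> (adj ?F)\<^sup>*"
    using T by (metis Compl_iff)
  then have "(p, q) \<notin> conn_rel W ?F" by (simp add: conn_rel_def)
  moreover have "(p, q) \<in> conn_rel W F"
    using F[OF \<open>b \<in> F\<close>] \<open>b \<in> F\<close> b by (auto simp: conn_rel_def adj_def)
  moreover have "conn_rel W ?F \<subseteq> conn_rel W F"
  proof -
    have "(adj ?F)\<^sup>* \<subseteq> (adj F)\<^sup>*"
      by (intro rtrancl_mono) (auto simp: adj_def)
    then show ?thesis by (auto simp: conn_rel_def)
  qed
  ultimately show "is_bridge W F b"
    using card_quotient_less[OF assms(1) equiv_conn_rel equiv_conn_rel, of ?F F p q] \<open>b \<in> F\<close>
    by (simp add: is_bridge_def num_components_def)
qed

lemma two_edge_connected_delta_neq: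
  assumes "finite W" "\<And>b. b \<in> F \<Longrightarrow> b \<subseteq> W \<and> card b = 2" "two_edge_connected W F"
  shows "delta F T \<noteq> {b}"
proof
  assume "delta F T = {b}"
  then have "is_bridge W F b"
    using is_bridge_iff_delta[OF assms(1,2)] by auto
  moreover from this have "b \<in> F"
    by (simp add: is_bridge_def)
  ultimately show False
    using assms(3) by (auto simp: two_edge_connected_def)
qed

lemma bridgeless_part_subset: "bridgeless_part X \<subseteq> X"
  by (auto simp: bridgeless_part_def)

text \<open>Deleting all bridges at once creates no new ones. A bridge \<open>c\<close> in the cut
  of \<open>T\<close> is removed by adding a set \<open>T'\<close> with the cut \<open>{c}\<close>:
  the cut in \<open>X\<close> shrinks, the one in the bridgeless part stays.\<close>

lemma delta_bridgeless_part_neq: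
  assumes "finite X" "\<And>b. b \<in> X \<Longrightarrow> card b = 2"
  shows "delta (bridgeless_part X) T \<noteq> {b}"
proof (induction "card (delta X T)" arbitrary: T rule: less_induct)
  case less
  show ?case
  proof
    assume b: "delta (bridgeless_part X) T = {b}"
    then have bX: "b \<in> bridgeless_part X" "b \<in> delta X T"
      using delta_restrict[OF bridgeless_part_subset, of X T] by auto
    then have "delta X T \<noteq> {b}"
      by (auto simp: bridgeless_part_def)
    then obtain c where c: "c \<in> delta X T" "c \<noteq> b"
      using bX by blast
    then have "c \<notin> bridgeless_part X" "c \<in> X"
      using b delta_restrict[OF bridgeless_part_subset, of X T] delta_subset[of X T] by auto
    then obtain T' where T': "delta X T' = {c}"
      by (auto simp: bridgeless_part_def)
    let ?T = "sym_diff T T'"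
    have *: "delta X ?T = delta X T - {c}"
      using mem_delta_sym_diff_iff[OF assms(2), of X _ T T'] T' c delta_subset[of X T] by auto
    have "finite (delta X T)"
      using assms(1) delta_subset finite_subset by metis
    then have "card (delta X ?T) < card (delta X T)"
      unfolding * using c(1) by (intro psubset_card_mono) auto
    moreover have "delta (bridgeless_part X) ?T = {b}"
      using b * \<open>c \<notin> bridgeless_part X\<close>
      unfolding delta_restrict[OF bridgeless_part_subset] by auto
    ultimately show False
      using less by blast
  qed
qed

text \<open>No edge of \<open>F\<close> leaves \<open>W\<close>, so a cut of the component by
  \<open>T\<close> is the cut of all of \<open>F\<close> by \<open>T \<inter> W\<close>.\<close>

lemma two_edge_connected_component:
  assumes "finite W" and F: "\<And>b. b \<in> F \<Longrightarrow> card b = 2"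
    and neq: "\<And>T b. delta F T \<noteq> {b}"
    and W: "W = (adj F)\<^sup>* `` {p}"
  shows "two_edge_connected W {b \<in> F. b \<subseteq> W}"
proof -
  let ?F = "{b \<in> F. b \<subseteq> W}"
  have cut: "delta F W = {}"
    unfolding W by (rule delta_reachable[OF F])
  have reach: "(p, v) \<in> (adj ?F)\<^sup>*" if "(p, v) \<in> (adj F)\<^sup>*" for v
    using that
  proof (induction rule: rtrancl_induct)
    case (step y z)
    then have "(p, z) \<in> (adj F)\<^sup>*" "{y, z} \<in> F"
      by (meson rtrancl_into_rtrancl, simp add: adj_def)
    with step.hyps(1) have "y \<in> W" "z \<in> W" "{y, z} \<in> F"
      using W by auto
    then have "(y, z) \<in> adj ?F" by (auto simp: adj_def)
    then show ?case using step.IH by auto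
  qed simp
  have "connected_graph W ?F"
    unfolding connected_graph_def
  proof (intro ballI)
    fix u v assume "u \<in> W" "v \<in> W"
    then have "(p, u) \<in> (adj ?F)\<^sup>*" "(p, v) \<in> (adj ?F)\<^sup>*"
      using W reach by auto
    then show "(u, v) \<in> (adj ?F)\<^sup>*"
      using sym_adj_rtrancl[of ?F] by (meson rtrancl_trans symD)
  qed
  moreover have "\<not> is_bridge W ?F b" for b
  proof
    assume "is_bridge W ?F b"
    then obtain T where T: "delta ?F T = {b}"
      using is_bridge_iff_delta[of W ?F] assms(1) F by auto
    have "c \<in> delta F (T \<inter> W) \<longleftrightarrow> c \<in> delta ?F T" for c
    proof (cases "c \<in> F")
      case True
      then obtain y z where c: "c = {y, z}" "y \<noteq> z"
        using F by (metis card_2_iff)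
      have "y \<in> W \<longleftrightarrow> z \<in> W"
        using cut True c delta_pair_iff[of y z F W] by blast
      then show ?thesis
        using True c delta_pair_iff[of y z F] delta_pair_iff[of y z ?F] by auto
    qed (auto simp: delta_def)
    then have "delta F (T \<inter> W) = {b}"
      using T by blast
    then show False using neq by blast
  qed
  ultimately show ?thesis
    by (simp add: two_edge_connected_def)
qed

subsection \<open>Incidence vectors and cut inequalities\<close>

lemma incidence_Un_disjoint: "A \<inter> B = {} \<Longrightarrow> incidence (A \<union> B) = incidence A + incidence B"
  by (auto simp: incidence_def vec_eq_iff)

lemma incidence_Diff: "B \<subseteq> A \<Longrightarrow> incidence (A - B) = incidence A - incidence B"
  by (auto simp: incidence_def vec_eq_iff)

lemma incidence_empty: "incidence {} = 0"
  by (auto simp: incidence_def vec_eq_iff)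

text \<open>The maximal members of a laminar family are disjoint and have the same union.\<close>

lemma incidence_Union_laminar:
  assumes "finite \<A>" "subspace U" "\<And>A. A \<in> \<A> \<Longrightarrow> incidence A \<in> U"
    and "\<And>A B. A \<in> \<A> \<Longrightarrow> B \<in> \<A> \<Longrightarrow> A \<subseteq> B \<or> B \<subseteq> A \<or> A \<inter> B = {}"
  shows "incidence (\<Union>\<A>) \<in> U"
  using assms(1,3,4)
proof (induction \<A> rule: finite_psubset_induct)
  case (psubset \<A>)
  show ?case
  proof (cases "\<A> = {}")
    case True
    then show ?thesis using assms(2) by (simp add: incidence_empty subspace_0)
  next
    case False
    then obtain A where A: "A \<in> \<A>" "\<And>B. B \<in> \<A> \<Longrightarrow> A \<subseteq> B \<Longrightarrow> B = A"
      using finite_has_maximal[of \<A>] psubset.hyps(1) by metis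
    let ?B = "{B \<in> \<A>. A \<inter> B = {}} - {A}"
    have "?B \<subset> \<A>" using A(1) by blast
    then have "incidence (\<Union>?B) \<in> U"
    proof (rule psubset.IH)
      show "incidence B \<in> U" if "B \<in> ?B" for B
        using that psubset.prems(1) by simp
      show "B \<subseteq> C \<or> C \<subseteq> B \<or> B \<inter> C = {}" if "B \<in> ?B" "C \<in> ?B" for B C
        using that psubset.prems(2) by simp
    qed
    moreover have "\<Union>\<A> = A \<union> \<Union>?B"
    proof -
      have "B \<subseteq> A \<or> B \<in> ?B" if "B \<in> \<A>" for B
        using psubset.prems(2)[OF A(1) that] A(2)[OF that] that by auto
      then show ?thesis using A(1) by blast
    qed
    moreover have "A \<inter> \<Union>?B = {}" by blast
    ultimately show ?thesis
      using subspace_add[OF assms(2) psubset.prems(1)[OF A(1)], of "incidence (\<Union>?B)"]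
        incidence_Un_disjoint[of A "\<Union>?B"] by simp
  qed
qed

lemma delta_sym_diff:
  assumes "\<And>b. b \<in> E \<Longrightarrow> card b = 2"
  shows "delta E (sym_diff A B) = sym_diff (delta E A) (delta E B)"
  using mem_delta_sym_diff_iff[OF assms, of E _ A B] delta_subset[of E] by auto

definition cut_form :: "'v::finite set set \<Rightarrow> 'v set \<Rightarrow> real ^ ('v set) \<Rightarrow> real" where
  "cut_form D e x = x $ e - (\<Sum>f\<in>D - {e}. x $ f)"

text \<open>Incidence vectors forget isolated vertices, so the vertex set is quantified
  away.\<close>

definition two_edge_connected_edges :: "'v set \<Rightarrow> 'v set set \<Rightarrow> 'v set set \<Rightarrow> bool" where
  "two_edge_connected_edges V E F \<longleftrightarrow>
     (\<exists>W\<subseteq>V. F \<subseteq> E \<and> (\<forall>b\<in>F. b \<subseteq> W) \<and> two_edge_connected W F)"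

lemma TECSP_eq: "TECSP V E = convex hull (incidence ` {F. two_edge_connected_edges V E F})"
  unfolding TECSP_def two_edge_connected_edges_def by (rule arg_cong[of _ _ "(hull) convex"]) auto

lemma convex_TECSP: "convex (TECSP V E)"
  by (simp add: TECSP_eq)

lemma incidence_in_TECSP: "two_edge_connected_edges V E F \<Longrightarrow> incidence F \<in> TECSP V E"
  by (simp add: TECSP_eq hull_inc)

text \<open>Needed to apply the results on halfspaces and supporting hyperplanes.\<close>

lemma cut_form_inner:
  assumes "e \<in> D"
  shows "cut_form D e x = (\<chi> i. if i = e then 1 else if i \<in> D then -1 else 0) \<bullet> x"
proof -
  have "(\<chi> i. if i = e then 1 else if i \<in> D then -1 else 0) \<bullet> x
    = (\<Sum>i\<in>UNIV. (if i = e then x $ i else 0) - (if i \<in> D - {e} then x $ i else 0))"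
    unfolding inner_vec_def by (intro sum.cong) (auto simp: assms)
  also have "\<dots> = x $ e - (\<Sum>f\<in>D - {e}. x $ f)"
    by (simp add: sum_subtractf sum.delta flip: sum.inter_filter) (simp add: sum.inter_restrict[symmetric] set_diff_eq)
  finally show ?thesis by (simp add: cut_form_def)
qed

lemma cut_form_incidence:
  "cut_form D e (incidence F) = (if e \<in> F then 1 else 0) - real (card (F \<inter> (D - {e})))"
proof -
  have "(\<Sum>f\<in>D - {e}. incidence F $ f) = (\<Sum>f\<in>D - {e}. if f \<in> F then 1 else 0)"
    by (simp add: incidence_def)
  also have "\<dots> = real (card (F \<inter> (D - {e})))"
    by (simp add: sum.If_cases Int_commute)
  finally show ?thesis by (simp add: cut_form_def incidence_def)
qed

subsection \<open>Two-edge-connected graphs\<close>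

locale two_edge_connected_graph =
  fixes V :: "'v::finite set" and E :: "'v set set"
  assumes simple: "simple_graph V E" and tec: "two_edge_connected V E"
begin

lemma card_edge: "b \<in> E \<Longrightarrow> card b = 2" and edge_subset: "b \<in> E \<Longrightarrow> b \<subseteq> V"
  using simple by (auto simp: simple_graph_def)

lemma delta_sd: "delta E (sym_diff A B) = sym_diff (delta E A) (delta E B)"
  using card_edge by (rule delta_sym_diff)

lemma delta_neq: "delta E T \<noteq> {b}"
  using two_edge_connected_delta_neq[of V E] tec card_edge edge_subset by auto

lemma delta_empty: "delta E T = {} \<Longrightarrow> T \<inter> V = {} \<or> V \<subseteq> T"
  using adj_rtrancl_closed[of E T, OF card_edge] tec
  unfolding two_edge_connected_def connected_graph_def by (meson disjoint_iff subsetI)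

lemma delta_Int_V: "delta E (T \<inter> V) = delta E T"
proof -
  have "b \<inter> (T \<inter> V) = b \<inter> T" if "b \<in> E" for b
    using edge_subset[OF that] by auto
  then show ?thesis by (auto simp: delta_def)
qed

lemma delta_V: "delta E V = {}"
  using edge_subset card_edge by (auto simp: delta_def Int_absorb2)

lemma delta_is_cut:
  assumes "delta E T \<noteq> {}"
  shows "is_cut V E (delta E T)"
proof -
  have "delta E {} = {}" by (simp add: delta_def)
  then have "T \<inter> V \<noteq> {}" "T \<inter> V \<noteq> V"
    using assms delta_Int_V[of T] delta_V by auto
  then show ?thesis
    unfolding is_cut_def using delta_Int_V[of T] by (intro exI[of _ "T \<inter> V"]) auto
qed

lemma two_edge_connected_edges_cut:
  assumes "two_edge_connected_edges V E F"
  shows "F \<subseteq> E" "F \<inter> delta E T \<noteq> {b}"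
proof -
  obtain W where W: "W \<subseteq> V" "F \<subseteq> E" "\<forall>b\<in>F. b \<subseteq> W" "two_edge_connected W F"
    using assms by (auto simp: two_edge_connected_edges_def)
  then show "F \<subseteq> E" by simp
  have "delta F T \<noteq> {b}"
    by (rule two_edge_connected_delta_neq[OF _ _ W(4)]) (use W card_edge in auto)
  then show "F \<inter> delta E T \<noteq> {b}"
    using delta_restrict[OF W(2)] by simp
qed

lemma two_edge_connected_edges_self: "two_edge_connected_edges V E E"
  using tec edge_subset by (auto simp: two_edge_connected_edges_def)

lemma two_edge_connected_edges_empty: "two_edge_connected_edges V E {}"
  by (auto simp: two_edge_connected_edges_def two_edge_connected_def connected_graph_def
      intro!: exI[of _ "{}"])

text \<open>These are the edge sets of the components of \<open>F\<close>; two of them with a common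
  edge share a vertex and hence coincide.\<close>

lemma two_edge_connected_decomposition:
  assumes "F \<subseteq> E" and neq: "\<And>T b. delta F T \<noteq> {b}"
  obtains \<A> where "\<Union>\<A> = F" "\<And>H. H \<in> \<A> \<Longrightarrow> two_edge_connected_edges V E H"
    "\<And>H H'. H \<in> \<A> \<Longrightarrow> H' \<in> \<A> \<Longrightarrow> H = H' \<or> H \<inter> H' = {}"
proof -
  define W where "W p = (adj F)\<^sup>* `` {p}" for p
  define C where "C p = {b \<in> F. b \<subseteq> W p}" for p
  have F: "card b = 2" if "b \<in> F" for b
    using assms(1) card_edge that by auto
  have W_eq: "W p = W q" if "q \<in> W p" for p q
    using that sym_adj_rtrancl[of F] unfolding W_def by (auto dest: symD intro: rtrancl_trans)
  have W_V: "W p \<subseteq> V" if "p \<in> V" for p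
  proof
    fix v assume "v \<in> W p"
    then have "(p, v) \<in> (adj F)\<^sup>*" by (simp add: W_def)
    then show "v \<in> V"
      using that by (induction) (use assms(1) edge_subset in \<open>auto simp: adj_def\<close>)
  qed
  have "\<Union>(C ` V) = F"
  proof -
    have "\<exists>p\<in>V. b \<in> C p" if bF: "b \<in> F" for b
    proof -
      obtain p q where b: "b = {p, q}" using F[OF bF] by (auto simp: card_2_iff)
      then have "(p, q) \<in> adj F" using bF by (simp add: adj_def)
      then have "b \<subseteq> W p" unfolding b W_def by auto
      moreover have "p \<in> V" using bF assms(1) edge_subset[of b] b by auto
      ultimately show ?thesis using bF by (auto simp: C_def)
    qed
    then show ?thesis by (auto simp: C_def)
  qed
  moreover have "two_edge_connected_edges V E (C p)" if "p \<in> V" for p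
  proof -
    have "two_edge_connected (W p) (C p)"
      unfolding C_def by (rule two_edge_connected_component[OF _ F neq W_def]) simp_all
    then show ?thesis
      unfolding two_edge_connected_edges_def using W_V[OF that] assms(1)
      by (intro exI[of _ "W p"]) (auto simp: C_def)
  qed
  moreover have "C p = C q \<or> C p \<inter> C q = {}" for p q
  proof (cases "C p \<inter> C q = {}")
    case False
    then obtain b where "b \<in> F" "b \<subseteq> W p" "b \<subseteq> W q" by (auto simp: C_def)
    moreover from this have "b \<noteq> {}" using F by fastforce
    ultimately obtain v where "v \<in> W p" "v \<in> W q" by auto
    then have "W p = W q" using W_eq[of v p] W_eq[of v q] by simp
    then show ?thesis by (simp add: C_def)
  qed simp
  ultimately show ?thesis
    by (intro that[of "C ` V"]) auto
qed

lemma bridgeless_part_iff: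
  "X \<subseteq> E \<Longrightarrow> b \<in> bridgeless_part X \<longleftrightarrow> b \<in> X \<and> (\<forall>T. X \<inter> delta E T \<noteq> {b})"
  by (simp add: bridgeless_part_def delta_restrict)

lemma bridgeless_part_decomposition:
  assumes "X \<subseteq> E"
  obtains \<A> where "\<Union>\<A> = bridgeless_part X" "\<And>H. H \<in> \<A> \<Longrightarrow> two_edge_connected_edges V E H"
    "\<And>H H'. H \<in> \<A> \<Longrightarrow> H' \<in> \<A> \<Longrightarrow> H = H' \<or> H \<inter> H' = {}"
proof (rule two_edge_connected_decomposition[of "bridgeless_part X"])
  show "bridgeless_part X \<subseteq> E"
    using assms bridgeless_part_subset by blast
  show "delta (bridgeless_part X) T \<noteq> {b}" for T b
    using delta_bridgeless_part_neq[of X] assms card_edge by (auto simp: finite_subset)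
qed (rule that)

text \<open>A bridgeless subgraph containing \<open>e\<close> has a second edge in the cut, so all
  generators lie in the halfspace, and with them their hull. The set \<open>T\<close> is arbitrary
  because the necessity proof also needs other cuts than the given one.\<close>

lemma cut_form_valid:
  assumes "e \<in> delta E T" "x \<in> TECSP V E"
  shows "cut_form (delta E T) e x \<le> 0"
proof -
  let ?a = "\<chi> i. if i = e then 1 else if i \<in> delta E T then -1 else (0::real)"
  have "cut_form (delta E T) e (incidence F) \<le> 0" if F: "two_edge_connected_edges V E F" for F
  proof (cases "e \<in> F")
    case True
    then have "F \<inter> delta E T - {e} \<noteq> {}"
      using two_edge_connected_edges_cut(2)[OF F, of T e] assms(1) by auto
    then have "F \<inter> (delta E T - {e}) \<noteq> {}" by blast
    then have "card (F \<inter> (delta E T - {e})) \<ge> 1"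
      by (simp add: Suc_le_eq card_gt_0_iff)
    then show ?thesis by (simp add: cut_form_incidence)
  qed (simp add: cut_form_incidence)
  then have "incidence ` {F. two_edge_connected_edges V E F} \<subseteq> {x. ?a \<bullet> x \<le> 0}"
    by (auto simp: cut_form_inner[OF assms(1), symmetric])
  then have "TECSP V E \<subseteq> {x. ?a \<bullet> x \<le> 0}"
    unfolding TECSP_eq by (simp add: hull_minimal convex_halfspace_le)
  then show ?thesis
    using assms(2) by (auto simp: cut_form_inner[OF assms(1)])
qed

lemma cut_form_face:
  assumes "e \<in> delta E T"
  shows "(TECSP V E \<inter> {x. cut_form (delta E T) e x = 0}) face_of TECSP V E"
  unfolding cut_form_inner[OF assms]
  by (rule face_of_Int_supporting_hyperplane_le[OF convex_TECSP])
    (simp add: cut_form_valid[OF assms] flip: cut_form_inner[OF assms])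

section \<open>Series classes and 2-cuts\<close>

text \<open>For a non-bridge \<open>d\<close> of \<open>X\<close>, the edges in series with
  \<open>d\<close>; for \<open>X = E\<close> this is the coparallel class of
  \<open>d\<close>.\<close>

definition series_class :: "'v set set \<Rightarrow> 'v set \<Rightarrow> 'v set set" where
  "series_class X d = {b \<in> X. b = d \<or> (\<exists>T. X \<inter> delta E T = {b, d})}"

text \<open>If \<open>{b, d}\<close> is a cut of \<open>X\<close>, then \<open>b\<close> becomes a
  bridge once \<open>d\<close> is deleted. It is no bridge of \<open>X\<close> itself, since the
  cuts \<open>{b}\<close> and \<open>{b, d}\<close> would add up to \<open>{d}\<close>. Class
  vectors thus become differences of vectors of bridgeless parts.\<close>

lemma series_class_eq:
  assumes "X \<subseteq> E" "d \<in> bridgeless_part X"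
  shows "series_class X d = bridgeless_part X - bridgeless_part (X - {d})"
proof -
  have X': "X - {d} \<subseteq> E" using assms(1) by auto
  have dX: "d \<in> X" "X \<inter> delta E T \<noteq> {d}" for T
    using assms by (auto simp: bridgeless_part_iff)
  have "b \<in> series_class X d \<longleftrightarrow> b \<in> bridgeless_part X \<and> b \<notin> bridgeless_part (X - {d})" for b
  proof (cases "b = d")
    case True
    then show ?thesis
      using assms(2) dX(1) bridgeless_part_subset[of "X - {d}"] by (auto simp: series_class_def)
  next
    case False
    show ?thesis
    proof
      assume "b \<in> series_class X d"
      then obtain T where T: "b \<in> X" "X \<inter> delta E T = {b, d}"
        using False by (auto simp: series_class_def)
      have "X \<inter> delta E T' \<noteq> {b}" for T'
      proof
        assume "X \<inter> delta E T' = {b}"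
        then have "X \<inter> delta E (sym_diff T T') = {d}"
          unfolding delta_sd using T(2) False by auto
        then show False using dX by blast
      qed
      moreover have "(X - {d}) \<inter> delta E T = {b}"
        using T False by auto
      ultimately show "b \<in> bridgeless_part X \<and> b \<notin> bridgeless_part (X - {d})"
        using T(1) by (simp add: bridgeless_part_iff[OF assms(1)] bridgeless_part_iff[OF X']) blast
    next
      assume *: "b \<in> bridgeless_part X \<and> b \<notin> bridgeless_part (X - {d})"
      then obtain T where T: "b \<in> X" "(X - {d}) \<inter> delta E T = {b}" "X \<inter> delta E T \<noteq> {b}"
        using False by (auto simp: bridgeless_part_iff[OF assms(1)] bridgeless_part_iff[OF X'])
      then have "X \<inter> delta E T = {b, d}" using dX(1) by auto
      then show "b \<in> series_class X d" using T(1) by (auto simp: series_class_def)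
    qed
  qed
  then show ?thesis by blast
qed

lemma bridgeless_part_Diff_subset:
  assumes "X \<subseteq> E"
  shows "bridgeless_part (X - {d}) \<subseteq> bridgeless_part X"
proof
  fix b assume b: "b \<in> bridgeless_part (X - {d})"
  have X': "X - {d} \<subseteq> E" using assms by auto
  have "X \<inter> delta E T \<noteq> {b}" for T
    using b unfolding bridgeless_part_iff[OF X'] by auto
  then show "b \<in> bridgeless_part X"
    using b unfolding bridgeless_part_iff[OF X'] bridgeless_part_iff[OF assms] by auto
qed

lemma self_mem_series_class: "d \<in> E \<Longrightarrow> d \<in> series_class E d"
  by (simp add: series_class_def)

lemma mem_series_class_iff: "d \<in> E \<Longrightarrow> b \<in> series_class E d \<longleftrightarrow> b = d \<or> (\<exists>T. delta E T = {b, d})"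
  using delta_subset[of E] by (auto simp: series_class_def Int_absorb1)

text \<open>The 2-cuts \<open>{b, d}\<close> and \<open>{c, d}\<close> add up to
  \<open>{b, c}\<close>, so lying in a common 2-cut is transitive.\<close>

lemma series_class_cong:
  assumes "b \<in> series_class E d" "d \<in> E"
  shows "series_class E b = series_class E d"
proof (cases "b = d")
  case False
  then obtain T where T: "delta E T = {b, d}"
    using assms(1) unfolding mem_series_class_iff[OF assms(2)] by auto
  have "b \<in> E" using assms(1) by (simp add: series_class_def)
  \<comment> \<open>Stated symmetrically in \<open>b\<close> and \<open>d\<close>, to give both
    inclusions.\<close>
  have "c \<in> series_class E p" if cq: "c \<in> series_class E q" "{p, q} = {b, d}" for c p q
  proof -
    have pq: "p \<in> E" "q \<in> E" "delta E T = {p, q}" "p \<noteq> q"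
      using cq(2) T assms(2) \<open>b \<in> E\<close> False by (auto simp: doubleton_eq_iff)
    show ?thesis
    proof (cases "c = p \<or> c = q")
      case True
      then show ?thesis using pq unfolding mem_series_class_iff[OF pq(1)] by (metis insert_commute)
    next
      case c: False
      then obtain T' where "delta E T' = {c, q}"
        using cq(1) unfolding mem_series_class_iff[OF pq(2)] by auto
      then have "delta E (sym_diff T T') = {c, p}"
        unfolding delta_sd using pq c by auto
      then show ?thesis unfolding mem_series_class_iff[OF pq(1)] by blast
    qed
  qed
  from this[of _ b d] this[of _ d b] show ?thesis by auto
qed simp

text \<open>A bridgeless subgraph cannot meet a 2-cut in one edge. Hence its edge set is a union of
  classes.\<close>

lemma series_class_subset:
  assumes "two_edge_connected_edges V E F" "d \<in> F"
  shows "series_class E d \<subseteq> F"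
proof
  fix b assume "b \<in> series_class E d"
  moreover have "d \<in> E" using assms two_edge_connected_edges_cut(1) by blast
  ultimately consider "b = d" | T where "delta E T = {b, d}"
    using mem_series_class_iff by blast
  then show "b \<in> F"
  proof cases
    case 2
    then show ?thesis
      using two_edge_connected_edges_cut(2)[OF assms(1), of T d] assms(2) by auto
  qed (use assms in simp)
qed

section \<open>Coparallel classes and bridges of induced subgraphs\<close>

lemma not_is_bridge: "\<not> is_bridge V E b"
  using tec by (auto simp: two_edge_connected_def is_bridge_def)

text \<open>A 2-cut is automatically minimal, as \<open>G\<close> has neither empty cuts nor cuts of
  size one.\<close>

lemma coparallel_iff: "coparallel V E b f \<longleftrightarrow> b \<noteq> f \<and> (\<exists>T. delta E T = {b, f})"
proof
  assume "coparallel V E b f"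
  then show "b \<noteq> f \<and> (\<exists>T. delta E T = {b, f})"
    by (auto simp: coparallel_def minimal_cut_def is_cut_def)
next
  assume *: "b \<noteq> f \<and> (\<exists>T. delta E T = {b, f})"
  then obtain T where T: "delta E T = {b, f}" by auto
  have "F = {b, f}" if F: "is_cut V E F" "F \<subseteq> {b, f}" for F
  proof -
    obtain U where U: "{} \<subset> U" "U \<subset> V" "F = delta E U"
      using F(1) by (auto simp: is_cut_def)
    then have "F \<noteq> {}" using delta_empty[of U] by auto
    then show ?thesis using F(2) delta_neq[of U] U(3) by blast
  qed
  moreover have "is_cut V E {b, f}" using delta_is_cut[of T] T by simp
  ultimately show "coparallel V E b f"
    using * T delta_subset[of E T] by (auto simp: coparallel_def minimal_cut_def)
qed

text \<open>By finiteness, a coparallel pair extends to a maximal pairwise coparallel set.\<close>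

lemma common_coparallel_class_iff:
  assumes "b \<noteq> f"
  shows "(\<exists>C. coparallel_class V E C \<and> b \<in> C \<and> f \<in> C) \<longleftrightarrow> (\<exists>T. delta E T = {b, f})"
proof
  assume "\<exists>C. coparallel_class V E C \<and> b \<in> C \<and> f \<in> C"
  then have "coparallel V E b f"
    using assms by (auto simp: coparallel_class_def copar_set_def)
  then show "\<exists>T. delta E T = {b, f}" by (simp add: coparallel_iff)
next
  assume "\<exists>T. delta E T = {b, f}"
  then have "coparallel V E b f" "coparallel V E f b"
    using assms by (auto simp: coparallel_iff insert_commute)
  then have "{b, f} \<in> {C. copar_set V E C}"
    by (auto simp: copar_set_def not_is_bridge coparallel_def)
  then obtain C where C: "C \<in> {C. copar_set V E C}" "{b, f} \<subseteq> C"
    "\<forall>C'\<in>{C. copar_set V E C}. C \<subseteq> C' \<longrightarrow> C = C'"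
    using finite_has_maximal2[of "{C. copar_set V E C}" "{b, f}"] by auto
  then have "coparallel_class V E C"
    by (auto simp: coparallel_class_def)
  then show "\<exists>C. coparallel_class V E C \<and> b \<in> C \<and> f \<in> C"
    using C(2) by auto
qed

lemma is_bridge_induced_iff:
  "is_bridge W (induced_edges E W) b \<longleftrightarrow> (\<exists>T. induced_edges E W \<inter> delta E T = {b})"
proof -
  have "induced_edges E W \<subseteq> E" by (auto simp: induced_edges_def)
  moreover have "is_bridge W (induced_edges E W) b \<longleftrightarrow> (\<exists>T. delta (induced_edges E W) T = {b})"
    by (rule is_bridge_iff_delta) (use card_edge in \<open>auto simp: induced_edges_def\<close>)
  ultimately show ?thesis by (simp add: delta_restrict)
qed

end

subsection \<open>The face of an asymmetric cut inequality\<close>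

locale minimal_cut_graph = two_edge_connected_graph V E for V :: "'v::finite set" and E +
  fixes S :: "'v set"
  assumes S: "S \<subset> V" and min_cut: "minimal_cut V E (delta E S)"
    and card_cut: "card (delta E S) \<ge> 3"
begin

abbreviation "D \<equiv> delta E S"
abbreviation "ES \<equiv> induced_edges E S"

definition face :: "'v set \<Rightarrow> (real ^ ('v set)) set" where
  "face e = TECSP V E \<inter> {x. cut_form D e x = 0}"

text \<open>All edges of the cut other than \<open>e\<close> and \<open>f\<close> are deleted; for
  the distinguished edge \<open>e\<close>, the 2-edge-connected subgraphs of what is left lie on the
  face.\<close>

definition pair_subgraph :: "'v set \<Rightarrow> 'v set \<Rightarrow> 'v set set" where
  "pair_subgraph e f = E - (D - {e, f})"

lemma cut_subset: "D \<subseteq> E"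
  by (rule delta_subset)

section \<open>Consequences of the minimality of the cut\<close>

lemma subset_cut: "delta E T \<subseteq> D \<Longrightarrow> delta E T = {} \<or> delta E T = D"
  using delta_is_cut min_cut by (auto simp: minimal_cut_def)

text \<open>The symmetric difference of the two cuts is a cut inside \<open>D\<close>, hence empty
  or \<open>D\<close>.\<close>

lemma cut_determined:
  assumes "(E - D) \<inter> delta E A = (E - D) \<inter> delta E B"
  shows "delta E A = delta E B \<or> delta E A = sym_diff (delta E B) D"
proof -
  have "c \<in> D" if "c \<in> sym_diff (delta E A) (delta E B)" for c
  proof (rule ccontr)
    assume "c \<notin> D"
    then have "c \<in> E - D" using that delta_subset[of E] by auto
    then show False using assms that by blast
  qed
  then have "delta E (sym_diff A B) = {} \<or> delta E (sym_diff A B) = D"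
    unfolding delta_sd[symmetric] by (intro subset_cut) blast
  then show ?thesis
    unfolding delta_sd by auto
qed

lemma pair_not_cut: "f \<in> D \<Longrightarrow> g \<in> D \<Longrightarrow> delta E T \<noteq> {f, g}"
proof
  assume "f \<in> D" "g \<in> D" "delta E T = {f, g}"
  then have "D = {f, g}" using subset_cut[of T] by auto
  moreover have "card {f, g} \<le> 2" by (simp add: card_insert_if)
  ultimately show False using card_cut by simp
qed

lemma ES_subset: "ES \<subseteq> E" and ES_disjoint: "ES \<inter> D = {}"
  using card_edge by (auto simp: induced_edges_def delta_def Int_absorb2)

lemma edge_cases: "b \<in> E \<Longrightarrow> b \<in> D \<or> b \<in> ES \<or> b \<in> induced_edges E (V - S)"
  using card_edge[of b] edge_subset[of b] delta_pair_iff[of _ _ E S]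
  by (auto simp: card_2_iff induced_edges_def)

text \<open>This is the connectivity of \<open>G[S]\<close>: the cut of \<open>A\<close> lies in
  \<open>D\<close>, so it is empty or \<open>D\<close>, and in the latter case \<open>S - A\<close>
  has an empty cut.\<close>

lemma cut_connected:
  assumes "A \<subseteq> S" "ES \<inter> delta E A = {}"
  shows "A = {} \<or> A = S"
proof -
  have empty: "delta E B = {} \<Longrightarrow> B \<subseteq> S \<Longrightarrow> B = {}" for B
    using delta_empty[of B] S by auto
  have "b \<notin> delta E A" if "b \<in> induced_edges E (V - S)" for b
  proof -
    have "b \<inter> A = {}" using that assms(1) by (auto simp: induced_edges_def)
    then show ?thesis by (simp add: delta_def)
  qed
  then have "delta E A \<subseteq> D"
    using assms(2) edge_cases delta_subset[of E A] by blast
  then consider "delta E A = {}" | "delta E A = D"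
    using subset_cut by blast
  then show ?thesis
  proof cases
    case 2
    then have "delta E (sym_diff S A) = {}" unfolding delta_sd by simp
    moreover have "sym_diff S A = S - A" using assms(1) by auto
    ultimately show ?thesis using empty[of "S - A"] assms(1) by auto
  qed (use empty assms in blast)
qed

text \<open>A cut of \<open>G[S]\<close> has two sides within \<open>S\<close>; chosen is the one
  that avoids the end of \<open>e\<close>.\<close>

lemma normalized_cut:
  assumes "e \<in> D"
  obtains Y where "Y \<subseteq> S" "ES \<inter> delta E Y = ES \<inter> delta E T" "e \<notin> delta E Y"
proof -
  have "b \<inter> (T \<inter> S) = b \<inter> T" if "b \<in> ES" for b
    using that by (auto simp: induced_edges_def)
  then have T: "ES \<inter> delta E (T \<inter> S) = ES \<inter> delta E T"
    by (auto simp: delta_def)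
  show ?thesis
  proof (cases "e \<in> delta E (T \<inter> S)")
    case True
    let ?Y = "sym_diff S (T \<inter> S)"
    have "ES \<inter> delta E ?Y = ES \<inter> delta E (T \<inter> S)" "e \<notin> delta E ?Y"
      unfolding delta_sd using ES_disjoint True assms by auto
    then show ?thesis using T by (intro that[of ?Y]) auto
  next
    case False
    then show ?thesis using T by (intro that[of "T \<inter> S"]) auto
  qed
qed

section \<open>Vectors in the span of the face\<close>

text \<open>A bridgeless \<open>H\<close> meets \<open>D\<close> in none or in both of
  \<open>e\<close> and \<open>f\<close>, and their contributions cancel.\<close>

lemma incidence_in_face:
  assumes "two_edge_connected_edges V E H" "e \<in> D" "H \<inter> D \<subseteq> {e, f}"
  shows "incidence H \<in> face e"
proof -
  have "H \<inter> D \<noteq> {e}" "H \<inter> D \<noteq> {f}"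
    using two_edge_connected_edges_cut(2)[OF assms(1)] by auto
  then consider "H \<inter> D = {}" | "H \<inter> D = {e, f}" "e \<noteq> f"
    using assms(3) by blast
  then have "cut_form D e (incidence H) = 0"
  proof cases
    case 1
    then have "e \<notin> H" "H \<inter> (D - {e}) = {}" using assms(2) by auto
    then show ?thesis by (simp add: cut_form_incidence)
  next
    case 2
    then have "e \<in> H" "H \<inter> (D - {e}) = {f}" by auto
    then show ?thesis by (simp add: cut_form_incidence)
  qed
  then show ?thesis
    using incidence_in_TECSP[OF assms(1)] by (simp add: face_def)
qed

text \<open>The bridgeless part is the disjoint union of 2-edge-connected pieces, each on the
  face.\<close>

lemma incidence_bridgeless_part:
  assumes "X \<subseteq> E" "e \<in> D" "X \<inter> D \<subseteq> {e, f}"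
  shows "incidence (bridgeless_part X) \<in> span (face e)"
proof -
  obtain \<A> where A: "\<Union>\<A> = bridgeless_part X"
    "\<And>H. H \<in> \<A> \<Longrightarrow> two_edge_connected_edges V E H"
    "\<And>H H'. H \<in> \<A> \<Longrightarrow> H' \<in> \<A> \<Longrightarrow> H = H' \<or> H \<inter> H' = {}"
    using bridgeless_part_decomposition[OF assms(1)] by metis
  have "incidence H \<in> span (face e)" if "H \<in> \<A>" for H
  proof (rule span_base, rule incidence_in_face[OF A(2)[OF that] assms(2)])
    have "H \<subseteq> X" using A(1) that bridgeless_part_subset[of X] by blast
    then show "H \<inter> D \<subseteq> {e, f}" using assms(3) by blast
  qed
  then show ?thesis
    unfolding A(1)[symmetric]
    by (intro incidence_Union_laminar) (use A(3) in auto)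
qed

lemma incidence_series_class:
  assumes "X \<subseteq> E" "e \<in> D" "X \<inter> D \<subseteq> {e, f}" "d \<in> bridgeless_part X"
  shows "incidence (series_class X d) \<in> span (face e)"
proof -
  have "incidence (bridgeless_part (X - {d})) \<in> span (face e)"
    using assms by (intro incidence_bridgeless_part[of _ e f]) auto
  then show ?thesis
    using incidence_bridgeless_part[OF assms(1-3)] bridgeless_part_Diff_subset[OF assms(1), of d]
    by (simp add: series_class_eq[OF assms(1,4)] incidence_Diff span_diff)
qed

text \<open>A cut isolating \<open>f\<close> would lie inside \<open>D\<close> and hence equal
  \<open>D\<close>, but \<open>D\<close> also contains \<open>g\<close>.\<close>

lemma pair_subgraph_bridgeless:
  assumes "f \<in> D" "g \<in> D" "f \<noteq> g"
  shows "f \<in> bridgeless_part (pair_subgraph f g)"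
proof -
  have X: "pair_subgraph f g \<subseteq> E" by (auto simp: pair_subgraph_def)
  have "pair_subgraph f g \<inter> delta E T \<noteq> {f}" for T
  proof
    assume T: "pair_subgraph f g \<inter> delta E T = {f}"
    then have "delta E T \<subseteq> D" 
      using assms delta_subset[of E T] by (auto simp: pair_subgraph_def)
    then have "delta E T = D" using subset_cut T by auto
    then show False using T assms cut_subset by (auto simp: pair_subgraph_def)
  qed
  then show ?thesis
    unfolding bridgeless_part_iff[OF X] using assms cut_subset by (auto simp: pair_subgraph_def)
qed

text \<open>Adding \<open>D\<close> to a cut \<open>{b, f}\<close> gives a cut that meets the pair
  subgraph in \<open>{b, e}\<close>. Conversely, \<open>b\<close> is a bridge of
  \<open>G - D\<close>, hence in a 2-cut with some \<open>g\<close> in \<open>D\<close>, and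
  \<open>cut_determined\<close> leaves only \<open>e\<close> and \<open>f\<close> for
  \<open>g\<close>.\<close>

lemma series_class_Un_eq:
  assumes e: "e \<in> D" and f: "f \<in> D" and "e \<noteq> f"
    and bridge: "\<And>b T. (E - D) \<inter> delta E T = {b} \<Longrightarrow> \<exists>g\<in>D. \<exists>T'. delta E T' = {b, g}"
  shows "series_class E e \<union> series_class E f = series_class (pair_subgraph e f) e"
proof -
  let ?X = "pair_subgraph e f"
  have X: "?X = (E - D) \<union> {e, f}"
    using e f cut_subset by (auto simp: pair_subgraph_def)
  have E: "e \<in> E" "f \<in> E" using e f cut_subset by auto
  show ?thesis
  proof (intro subset_antisym subsetI)
    fix b assume "b \<in> series_class E e \<union> series_class E f"
    then consider "b = e" | "b = f" | T where "b \<noteq> e" "b \<noteq> f" "delta E T = {b, e}"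
      | T where "b \<noteq> e" "b \<noteq> f" "delta E T = {b, f}"
      unfolding Un_iff mem_series_class_iff[OF E(1)] mem_series_class_iff[OF E(2)] by blast
    then show "b \<in> series_class ?X e"
    proof cases
      case 1
      then show ?thesis using X by (auto simp: series_class_def)
    next
      case 2
      have "?X \<inter> delta E S = {f, e}" using X e f by auto
      then show ?thesis using 2 X by (auto simp: series_class_def)
    next
      case 3
      then have "b \<in> E - D" using pair_not_cut e delta_subset[of E T] by auto
      then have "?X \<inter> delta E T = {b, e}" using 3 X by auto
      then show ?thesis using \<open>b \<in> E - D\<close> X by (auto simp: series_class_def)
    next
      case 4
      then have b: "b \<in> E - D" using pair_not_cut f delta_subset[of E T] by auto
      then have "?X \<inter> delta E (sym_diff T S) = {b, e}"
        unfolding delta_sd using 4 X e f \<open>e \<noteq> f\<close> by auto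
      then show ?thesis using b X unfolding series_class_def by blast
    qed
  next
    fix b assume b: "b \<in> series_class ?X e"
    show "b \<in> series_class E e \<union> series_class E f"
    proof (cases "b = e \<or> b = f")
      case True
      then show ?thesis using self_mem_series_class E by auto
    next
      case False
      then obtain T where T: "?X \<inter> delta E T = {b, e}" "b \<in> E - D"
        using b X by (auto simp: series_class_def)
      then have "(E - D) \<inter> delta E T = {b}" using X e by auto
      from bridge[OF this] obtain g T' where g: "g \<in> D" "delta E T' = {b, g}"
        by blast
      have "(E - D) \<inter> delta E T = (E - D) \<inter> delta E T'"
        unfolding g(2) \<open>(E - D) \<inter> delta E T = {b}\<close> using T(2) g(1) by auto
      then have "delta E T = {b, g} \<or> delta E T = sym_diff {b, g} D"
        using cut_determined[of T T'] unfolding g(2) by simp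
      then have "g = e \<or> g = f"
      proof
        assume "delta E T = {b, g}"
        then show ?thesis using T X False by auto
      next
        assume *: "delta E T = sym_diff {b, g} D"
        have "f \<notin> delta E T" using T(1) X \<open>e \<noteq> f\<close> False by blast
        then show ?thesis using f False unfolding * by auto
      qed
      then show ?thesis
        unfolding Un_iff mem_series_class_iff[OF E(1)] mem_series_class_iff[OF E(2)] using g(2) by auto
    qed
  qed
qed

text \<open>Turns statements on cut edges into statements on vertices of \<open>S\<close>, for use
  with nested sets.\<close>

lemma cut_edge_end:
  assumes "f \<in> D"
  obtains v where "v \<in> S" "\<forall>Y\<subseteq>S. f \<in> delta E Y \<longleftrightarrow> v \<in> Y"
proof -
  have fE: "f \<in> E" using assms cut_subset by auto
  obtain v w where f: "f = {v, w}" "v \<noteq> w" using card_edge[OF fE] by (auto simp: card_2_iff)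
  have d: "f \<in> delta E Y \<longleftrightarrow> (v \<in> Y) \<noteq> (w \<in> Y)" for Y
    using delta_pair_iff[OF f(2), of E Y] fE unfolding f(1) by simp
  show ?thesis
  proof (cases "v \<in> S")
    case True
    then have "w \<notin> S" using d[of S] assms by simp
    then show ?thesis using True d by (intro that[of v]) auto
  next
    case False
    then have "w \<in> S" using d[of S] assms by simp
    then show ?thesis using False d by (intro that[of w]) auto
  qed
qed

lemma delta_Int_subset: "delta E (A \<inter> B) \<subseteq> delta E A \<union> delta E B"
proof
  fix b assume b: "b \<in> delta E (A \<inter> B)"
  then have bE: "b \<in> E" using delta_subset[of E] by auto
  obtain v w where b': "b = {v, w}" "v \<noteq> w" using card_edge[OF bE] by (auto simp: card_2_iff)
  show "b \<in> delta E A \<union> delta E B"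
    using b delta_pair_iff[OF b'(2), of E] unfolding b'(1) by auto
qed

text \<open>In the connected graph obtained from \<open>G[S]\<close> by deleting the non-bridge \<open>d\<close>, the edges
  \<open>x\<close> and \<open>y\<close> are bridges. If all four quadrants of \<open>X\<close> and \<open>Y\<close> were nonempty, then connecting
  them would take three edges, but only \<open>x\<close> and \<open>y\<close> join different quadrants.\<close>

lemma nested_bridge_cuts:
  assumes d: "\<And>T. ES \<inter> delta E T \<noteq> {d}"
    and X: "X \<subseteq> S" "ES \<inter> delta E X = {x, d}" and Y: "Y \<subseteq> S" "ES \<inter> delta E Y = {y, d}"
    and neq: "x \<noteq> y" "x \<noteq> d" "y \<noteq> d"
    and meet: "X \<inter> Y \<noteq> {}" and union: "X \<union> Y \<noteq> S"
  shows "X \<subseteq> Y \<or> Y \<subseteq> X"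
proof (rule ccontr)
  assume not_nested: "\<not> (X \<subseteq> Y \<or> Y \<subseteq> X)"
  define G where "G A = ES \<inter> delta E A - {d}" for A
  have G_sd: "G (sym_diff A B) = sym_diff (G A) (G B)" for A B
    unfolding G_def delta_sd by blast
  have G_neq: "G A \<noteq> {}" if "A \<subseteq> S" "A \<noteq> {}" "A \<noteq> S" for A
  proof
    assume "G A = {}"
    then have "ES \<inter> delta E A = {} \<or> ES \<inter> delta E A = {d}" by (auto simp: G_def)
    then show False using cut_connected that d by blast
  qed
  have GX: "G X = {x}" and GY: "G Y = {y}"
    using X Y neq by (auto simp: G_def)
  have "G (X \<inter> Y) \<subseteq> G X \<union> G Y"
    using delta_Int_subset by (auto simp: G_def)
  then have sub: "G (X \<inter> Y) \<subseteq> {x, y}" unfolding GX GY by auto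
  have "sym_diff (X \<inter> Y) (X - Y) = X" "sym_diff (X \<inter> Y) (Y - X) = Y"
    "sym_diff X (Y - X) = X \<union> Y" by auto
  then have eqs: "sym_diff (G (X \<inter> Y)) (G (X - Y)) = {x}"
    "sym_diff (G (X \<inter> Y)) (G (Y - X)) = {y}" "G (X \<union> Y) = sym_diff {x} (G (Y - X))"
    using GX GY G_sd by metis+
  have ne: "G (X \<inter> Y) \<noteq> {}" "G (X - Y) \<noteq> {}" "G (Y - X) \<noteq> {}" "G (X \<union> Y) \<noteq> {}"
  proof -
    have *: "G A \<noteq> {}" if "A \<subseteq> X \<union> Y" "A \<noteq> {}" for A
      using that X(1) Y(1) union by (intro G_neq) auto
    show "G (X \<inter> Y) \<noteq> {}" "G (X - Y) \<noteq> {}" "G (Y - X) \<noteq> {}" "G (X \<union> Y) \<noteq> {}"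
      by (rule *; use not_nested meet in blast)+
  qed
  \<comment> \<open>Every quadrant needs an outgoing edge. Hence both \<open>x\<close> and
    \<open>y\<close> leave \<open>X \<inter> Y\<close>, and none is left for the quadrant outside
    \<open>X \<union> Y\<close>.\<close>
  have "G (X \<inter> Y) \<noteq> {x}" using eqs(1) ne(2) by auto
  moreover have "G (X \<inter> Y) \<noteq> {y}" using eqs(2) ne(3) by auto
  ultimately have "G (X \<inter> Y) = {x, y}" using sub ne(1) by blast
  then have "G (Y - X) = {x}" using eqs(2) neq(1) by auto
  then show False using eqs(3) ne(4) by simp
qed

text \<open>The sets \<open>A f\<close> below are determined by bridges of \<open>G[S] - d\<close> lying on one path: \<open>A f\<close> consists of
  those separating the end of \<open>f\<close> from the end of \<open>e\<close>.\<close>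

lemma incidence_series_class_inner:
  assumes e: "e \<in> D" and dES: "d \<in> ES" and d: "\<And>T. ES \<inter> delta E T \<noteq> {d}"
  shows "incidence (series_class E d) \<in> span (face e)"
proof -
  have inc: "incidence (series_class X d) \<in> span (face e)"
    if X: "X \<subseteq> E" "ES \<subseteq> X" "X \<inter> D \<subseteq> {e, f}" for X f
  proof -
    have "X \<inter> delta E T \<noteq> {d}" for T
      using d[of T] X(2) dES by blast
    then have mem: "d \<in> bridgeless_part X"
      using dES X(2) unfolding bridgeless_part_iff[OF X(1)] by auto
    show "incidence (series_class X d) \<in> span (face e)"
      by (rule incidence_series_class[OF X(1) e X(3) mem])
  qed
  have dE: "d \<in> E" using dES ES_subset by auto
  let ?R = "series_class ES d"
  let ?P = "\<lambda>f. series_class (pair_subgraph e f) d"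
  let ?A = "\<lambda>f. ?R - ?P f"
  have X: "pair_subgraph e f = (E - D) \<union> {e, f}" if "f \<in> D" for f
    using e that cut_subset by (auto simp: pair_subgraph_def)
  have P: "pair_subgraph e f \<subseteq> E" "ES \<subseteq> pair_subgraph e f" "pair_subgraph e f \<inter> D \<subseteq> {e, f}" for f
    using ES_subset ES_disjoint by (auto simp: pair_subgraph_def)
  have incR: "incidence ?R \<in> span (face e)"
    using inc[of ES] ES_subset ES_disjoint by auto
  have PR: "?P f \<subseteq> ?R" for f
  proof
    fix b assume b: "b \<in> ?P f"
    show "b \<in> ?R"
    proof (cases "b = d")
      case False
      then obtain T where T: "pair_subgraph e f \<inter> delta E T = {b, d}"
        using b by (auto simp: series_class_def)
      then have "ES \<inter> delta E T \<subseteq> {b, d}" "d \<in> ES \<inter> delta E T"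
        using P(2) dES by blast+
      then have "ES \<inter> delta E T = {b, d}" using d[of T] by blast
      then show ?thesis by (auto simp: series_class_def)
    qed (use dES in \<open>simp add: series_class_def\<close>)
  qed
  have incA: "incidence (?A f) \<in> span (face e)" for f
    using inc[OF P] incR by (simp add: incidence_Diff[OF PR] span_diff)
  have cut: "\<exists>Y\<subseteq>S. ES \<inter> delta E Y = {b, d} \<and> e \<notin> delta E Y"
    if bR: "b \<in> ?R" "b \<noteq> d" for b
  proof -
    obtain T where "ES \<inter> delta E T = {b, d}"
      using bR by (auto simp: series_class_def)
    then show ?thesis by (metis normalized_cut[OF e, of T])
  qed
  have outer: "induced_edges E (V - S) \<inter> delta E Y = {}" if "Y \<subseteq> S" for Y
  proof -
    have "b \<inter> Y = {}" if "b \<in> induced_edges E (V - S)" for b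
      using that \<open>Y \<subseteq> S\<close> by (auto simp: induced_edges_def)
    then show ?thesis by (auto simp: delta_def)
  qed
  have inner: "(E - D) \<inter> delta E Y = ES \<inter> delta E Y" if "Y \<subseteq> S" for Y
    using outer[OF that] edge_cases ES_subset ES_disjoint by blast
  \<comment> \<open>Off \<open>D\<close>, a cut witnessing \<open>b\<close> in \<open>?P f\<close>
    agrees with that of \<open>Y\<close>, so it is the cut of \<open>Y\<close> or its sum with
    \<open>D\<close>. The second contains \<open>e\<close>, so the first is the only candidate, and
    it fails exactly if it contains \<open>f\<close>.\<close>
  have A_iff: "b \<in> ?A f \<longleftrightarrow> f \<in> delta E Y"
    if b: "b \<in> ?R" "b \<noteq> d" and f: "f \<in> D" and Y: "Y \<subseteq> S" "ES \<inter> delta E Y = {b, d}" "e \<notin> delta E Y"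
    for b f Y
  proof -
    have bE: "b \<in> E - D" "d \<in> E - D" using b dES ES_subset ES_disjoint by (auto simp: series_class_def)
    have Y': "(E - D) \<inter> delta E Y = {b, d}" using inner[OF Y(1)] Y(2) by simp
    show ?thesis
    proof
      assume "b \<in> ?A f"
      then have "pair_subgraph e f \<inter> delta E Y \<noteq> {b, d}"
        using X[OF f] bE by (auto simp: series_class_def)
      then show "f \<in> delta E Y" using X[OF f] Y' Y(3) by blast
    next
      assume fY: "f \<in> delta E Y"
      have "pair_subgraph e f \<inter> delta E T \<noteq> {b, d}" for T
      proof
        assume T: "pair_subgraph e f \<inter> delta E T = {b, d}"
        then have "(E - D) \<inter> delta E T = (E - D) \<inter> delta E Y"
          using X[OF f] Y' bE by blast
        then consider "delta E T = delta E Y" | "delta E T = sym_diff (delta E Y) D"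
          using cut_determined by blast
        then show False
        proof cases
          case 1
          then show False using T fY X[OF f] bE f by auto
        next
          case 2
          then have "e \<in> delta E T" using e Y(3) by auto
          then show False using T X[OF f] bE e by auto
        qed
      qed
      then show "b \<in> ?A f" using b by (simp add: series_class_def)
    qed
  qed
  \<comment> \<open>If two sets cross, then \<open>x\<close> separates the ends of both
    \<open>f\<close> and \<open>g\<close> from that of \<open>e\<close>, \<open>y\<close> only that
    of \<open>f\<close> and \<open>z\<close> only that of \<open>g\<close>. So \<open>Y\<close> and
    \<open>Z\<close> are disjoint subsets of \<open>X\<close>; each contains exactly one end of
    \<open>d\<close>, which puts both ends into \<open>X\<close>.\<close>
  have laminar: "?A f \<subseteq> ?A g \<or> ?A g \<subseteq> ?A f \<or> ?A f \<inter> ?A g = {}" if f: "f \<in> D" and g: "g \<in> D" for f g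
  proof (rule ccontr)
    assume "\<not> ?thesis"
    then obtain x y z where xyz: "x \<in> ?A f" "x \<in> ?A g" "y \<in> ?A f" "y \<notin> ?A g" "z \<in> ?A g" "z \<notin> ?A f"
      by blast
    have dA: "d \<notin> ?A h" for h
      using P(2)[of h] dES by (auto simp: series_class_def)
    then have neq: "x \<noteq> d" "y \<noteq> d" "z \<noteq> d" "x \<noteq> y" "x \<noteq> z" "y \<noteq> z"
      using xyz by metis+
    have R: "x \<in> ?R" "y \<in> ?R" "z \<in> ?R" using xyz by auto
    obtain X where X: "X \<subseteq> S" "ES \<inter> delta E X = {x, d}" "e \<notin> delta E X"
      using cut[OF R(1) neq(1)] by auto
    obtain Y where Y: "Y \<subseteq> S" "ES \<inter> delta E Y = {y, d}" "e \<notin> delta E Y"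
      using cut[OF R(2) neq(2)] by auto
    obtain Z where Z: "Z \<subseteq> S" "ES \<inter> delta E Z = {z, d}" "e \<notin> delta E Z"
      using cut[OF R(3) neq(3)] by auto
    obtain u where u: "u \<in> S" "\<forall>Y\<subseteq>S. e \<in> delta E Y \<longleftrightarrow> u \<in> Y"
      by (rule cut_edge_end[OF e])
    obtain v where v: "v \<in> S" "\<forall>Y\<subseteq>S. f \<in> delta E Y \<longleftrightarrow> v \<in> Y"
      by (rule cut_edge_end[OF f])
    obtain w where w: "w \<in> S" "\<forall>Y\<subseteq>S. g \<in> delta E Y \<longleftrightarrow> w \<in> Y"
      by (rule cut_edge_end[OF g])
    have u': "u \<notin> X" "u \<notin> Y" "u \<notin> Z" using u(2) X Y Z by auto
    have vw: "v \<in> X" "w \<in> X" "v \<in> Y" "w \<notin> Y" "w \<in> Z" "v \<notin> Z"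
      using xyz A_iff[OF R(1) neq(1) f X] A_iff[OF R(1) neq(1) g X] A_iff[OF R(2) neq(2) f Y]
        A_iff[OF R(2) neq(2) g Y] A_iff[OF R(3) neq(3) f Z] A_iff[OF R(3) neq(3) g Z]
        v(2) w(2) X(1) Y(1) Z(1) by blast+
    have "Y \<subseteq> X"
      using nested_bridge_cuts[OF d X(1,2) Y(1,2) neq(4,1,2)] vw u' u(1) by blast
    moreover have "Z \<subseteq> X"
      using nested_bridge_cuts[OF d X(1,2) Z(1,2) neq(5,1,3)] vw u' u(1) by blast
    moreover have "Y \<inter> Z = {}"
      using nested_bridge_cuts[OF d Y(1,2) Z(1,2) neq(6,2,3)] vw u' u(1) by blast
    moreover obtain p q where pq: "d = {p, q}" "p \<noteq> q"
      using card_edge[OF dE] by (auto simp: card_2_iff)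
    moreover have "(p \<in> T) \<noteq> (q \<in> T)" if "ES \<inter> delta E T = {b, d}" for T b
    proof -
      have "d \<in> delta E T" using that by blast
      then show ?thesis using delta_pair_iff[OF pq(2), of E T] unfolding pq(1) by simp
    qed
    from this[OF X(2)] this[OF Y(2)] this[OF Z(2)]
    have "(p \<in> X) \<noteq> (q \<in> X)" "(p \<in> Y) \<noteq> (q \<in> Y)" "(p \<in> Z) \<noteq> (q \<in> Z)" .
    ultimately show False by blast
  qed
  \<comment> \<open>Some \<open>f0\<close> is needed to get from \<open>?P f0\<close> into
    \<open>?R\<close>.\<close>
  have "card (D - {e}) > 0" using card_cut e by simp
  then have "D - {e} \<noteq> {}" by (metis card.empty less_irrefl)
  then obtain f0 where f0: "f0 \<in> D - {e}" by blast
  have "series_class E d = ?R - \<Union>(?A ` (D - {e}))"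
  proof (intro subset_antisym subsetI)
    fix b assume b: "b \<in> series_class E d"
    have "b \<in> ?P f" if f: "f \<in> D" for f
    proof (cases "b = d")
      case True
      then show ?thesis using P(2) dES by (auto simp: series_class_def)
    next
      case False
      then obtain T where T: "delta E T = {b, d}"
        using b unfolding mem_series_class_iff[OF dE] by auto
      have "b \<in> ES"
      proof (rule ccontr)
        assume "b \<notin> ES"
        then have "ES \<inter> delta E T = {d}" unfolding T using dES by auto
        then show False using d by blast
      qed
      then have "b \<in> pair_subgraph e f" "d \<in> pair_subgraph e f" using P(2) dES by auto
      then show ?thesis unfolding series_class_def using T by blast
    qed
    then show "b \<in> ?R - \<Union>(?A ` (D - {e}))" using PR f0 by blast
  next
    fix b assume b: "b \<in> ?R - \<Union>(?A ` (D - {e}))"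
    show "b \<in> series_class E d"
    proof (cases "b = d")
      case False
      have bR: "b \<in> ?R" using b by auto
      obtain Y where Y: "Y \<subseteq> S" "ES \<inter> delta E Y = {b, d}" "e \<notin> delta E Y"
        using cut[OF bR False] by auto
      have "f \<notin> delta E Y" if f: "f \<in> D" for f
      proof (cases "f = e")
        case False
        then have "b \<notin> ?A f" using b f by blast
        then show ?thesis using A_iff[OF bR \<open>b \<noteq> d\<close> f Y] by blast
      qed (use Y(3) in simp)
      \<comment> \<open>No cut edge lies in the cut of \<open>Y\<close>, so the 2-cut of
        \<open>G[S]\<close> is a 2-cut of \<open>G\<close>.\<close>
      then have "delta E Y = {b, d}" 
        using inner[OF Y(1)] Y(2) delta_subset[of E Y] by auto
      then show ?thesis unfolding mem_series_class_iff[OF dE] by blast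
    qed (simp add: self_mem_series_class dE)
  qed
  moreover have "incidence (\<Union>(?A ` (D - {e}))) \<in> span (face e)"
    by (rule incidence_Union_laminar) (use incA laminar in auto)
  moreover have "\<Union>(?A ` (D - {e})) \<subseteq> ?R" by blast
  ultimately show ?thesis
    using incR by (simp add: incidence_Diff span_diff)
qed

section \<open>Sufficiency of the bridge condition\<close>

lemma delta_complement: "delta E (V - S) = D"
proof -
  have "sym_diff V S = V - S" using S by auto
  then have "delta E (V - S) = sym_diff (delta E V) D" using delta_sd by metis
  then show ?thesis by (simp add: delta_V)
qed

text \<open>Both sides have the same cut and the same face, so results on \<open>G[S]\<close>
  transfer to the other side.\<close>

lemma complement: "minimal_cut_graph V E (V - S)"
proof (unfold_locales, unfold delta_complement)
  have "S \<noteq> {}" using card_cut by (auto simp: delta_def)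
  then show "V - S \<subset> V" using S by auto
qed (use min_cut card_cut in simp_all)

lemma face_complement: "minimal_cut_graph.face V E (V - S) e = face e"
  by (simp add: minimal_cut_graph.face_def[OF complement] face_def delta_complement)

text \<open>One vector besides the face suffices: it yields the classes of all cut edges through the
  unions with the class of \<open>e\<close>, while the classes that contain no cut edge are in the
  span of the face already.\<close>

lemma TECSP_subset_span:
  assumes e: "e \<in> D"
    and bridge: "\<And>b T. ES \<inter> delta E T = {b} \<or> induced_edges E (V - S) \<inter> delta E T = {b}
      \<Longrightarrow> \<exists>g\<in>D. \<exists>T'. delta E T' = {b, g}"
  shows "TECSP V E \<subseteq> span (insert (incidence (series_class E e)) (face e))"
proof -
  let ?z = "incidence (series_class E e)"
  let ?U = "span (insert ?z (face e))"
  let ?ET = "induced_edges E (V - S)"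
  have ET: "?ET \<subseteq> E" "?ET \<inter> D = {}"
    using minimal_cut_graph.ES_subset[OF complement] minimal_cut_graph.ES_disjoint[OF complement]
    by (simp_all add: delta_complement)
  have bridge': "\<exists>g\<in>D. \<exists>T'. delta E T' = {b, g}" if b: "(E - D) \<inter> delta E T = {b}" for b T
  proof -
    have "b \<in> ES \<or> b \<in> ?ET" using b edge_cases by blast
    then have "ES \<inter> delta E T = {b} \<or> ?ET \<inter> delta E T = {b}"
      using b ES_subset ES_disjoint ET by blast
    then show ?thesis by (rule bridge)
  qed
  have sub: "span (face e) \<subseteq> ?U" by (rule span_mono) auto
  have z: "?z \<in> ?U" by (simp add: span_base)
  have cut_class: "incidence (series_class E f) \<in> ?U" if f: "f \<in> D" for f
  proof (cases "f = e")
    case False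
    have E: "e \<in> E" "f \<in> E" using e f cut_subset by auto
    have "pair_subgraph e f \<subseteq> E" "pair_subgraph e f \<inter> D \<subseteq> {e, f}" "e \<in> bridgeless_part (pair_subgraph e f)"
      using pair_subgraph_bridgeless[OF e f] False by (auto simp: pair_subgraph_def)
    then have "incidence (series_class (pair_subgraph e f) e) \<in> span (face e)"
      using incidence_series_class[OF _ e] by blast
    then have Un: "incidence (series_class E e \<union> series_class E f) \<in> ?U"
      using series_class_Un_eq[OF e f _ bridge'] False sub by auto
    \<comment> \<open>Disjointness lets the vector of the union split; a common class would make
      \<open>{f, e}\<close> a cut inside \<open>D\<close>, which has at least three edges.\<close>
    have "series_class E e \<inter> series_class E f = {}"
    proof (rule ccontr)
      assume "series_class E e \<inter> series_class E f \<noteq> {}"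
      then have "series_class E e = series_class E f"
        using series_class_cong E by (metis disjoint_iff)
      then have "f \<in> series_class E e" using self_mem_series_class E by auto
      then show False
        unfolding mem_series_class_iff[OF E(1)] using False pair_not_cut[OF f e] by auto
    qed
    then have "incidence (series_class E f)
        = incidence (series_class E e \<union> series_class E f) - ?z"
      by (simp add: incidence_Un_disjoint)
    then show ?thesis using span_diff[OF Un z] by simp
  qed (use z in simp)
  have "incidence (series_class E d) \<in> ?U" if d: "d \<in> E" for d
  proof (cases "\<exists>g\<in>D. \<exists>T. delta E T = {d, g}")
    case True
    then obtain g where g: "g \<in> D" "d \<in> series_class E g"
      using mem_series_class_iff cut_subset by blast
    then have "series_class E d = series_class E g"
      using series_class_cong cut_subset by blast
    then show ?thesis using cut_class[OF g(1)] by simp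
  next
    case False
    then have nb: "ES \<inter> delta E T \<noteq> {d}" "?ET \<inter> delta E T \<noteq> {d}" for T
      using bridge[of T d] by auto
    consider "d \<in> D" | "d \<in> ES" | "d \<in> ?ET" using edge_cases[OF d] by blast
    then show ?thesis
    proof cases
      case 1
      then show ?thesis by (rule cut_class)
    next
      case 2
      then show ?thesis using incidence_series_class_inner[OF e _ nb(1)] sub by blast
    next
      case 3
      then show ?thesis
        using minimal_cut_graph.incidence_series_class_inner[OF complement _ _ nb(2), of e] e sub
        unfolding delta_complement face_complement by blast
    qed
  qed
  moreover have "incidence H \<in> ?U"
    if H: "two_edge_connected_edges V E H" and classes: "\<And>d. d \<in> E \<Longrightarrow> incidence (series_class E d) \<in> ?U"
    for H
  proof -
    have HE: "H \<subseteq> E" by (rule two_edge_connected_edges_cut[OF H])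
    have "\<Union>(series_class E ` H) = H"
      using series_class_subset[OF H] self_mem_series_class HE by blast
    moreover have "incidence (\<Union>(series_class E ` H)) \<in> ?U"
    proof (rule incidence_Union_laminar)
      fix A B assume "A \<in> series_class E ` H" "B \<in> series_class E ` H"
      then obtain a b where "a \<in> E" "b \<in> E" "A = series_class E a" "B = series_class E b"
        using HE by blast
      then show "A \<subseteq> B \<or> B \<subseteq> A \<or> A \<inter> B = {}"
        using series_class_cong by (metis disjoint_iff order_refl)
    qed (use classes HE in auto)
    ultimately show ?thesis by simp
  qed
  ultimately show ?thesis
    unfolding TECSP_eq
    by (intro hull_minimal) (auto simp: subspace_imp_convex[OF subspace_span])
qed

lemma face_of_face: "e \<in> D \<Longrightarrow> face e face_of TECSP V E"
  unfolding face_def by (rule cut_form_face)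

lemma zero_in_face: "e \<in> D \<Longrightarrow> 0 \<in> face e"
  using incidence_in_face[OF two_edge_connected_edges_empty, of e e] by (simp add: incidence_empty)

text \<open>The whole graph violates equality, since the cut has at least two edges besides
  \<open>e\<close>.\<close>

lemma face_neq_TECSP:
  assumes "e \<in> D"
  shows "face e \<noteq> TECSP V E"
proof -
  have "card (D - {e}) \<ge> 2" using card_cut assms by simp
  moreover have "E \<inter> (D - {e}) = D - {e}" "e \<in> E" using cut_subset assms by auto
  ultimately have "cut_form D e (incidence E) < 0"
    by (simp add: cut_form_incidence)
  then have "incidence E \<notin> face e" by (simp add: face_def)
  then show ?thesis
    using incidence_in_TECSP[OF two_edge_connected_edges_self] by metis
qed

text \<open>Face and polytope contain 0, so affine and linear dimensions agree, and one extra vector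
  raises the latter by at most one.\<close>

lemma face_facet:
  assumes e: "e \<in> D"
    and bridge: "\<And>b T. ES \<inter> delta E T = {b} \<or> induced_edges E (V - S) \<inter> delta E T = {b}
      \<Longrightarrow> \<exists>g\<in>D. \<exists>T'. delta E T' = {b, g}"
  shows "face e facet_of TECSP V E"
proof -
  let ?z = "incidence (series_class E e)"
  have zero: "0 \<in> face e" "0 \<in> TECSP V E"
    using zero_in_face[OF e] by (auto simp: face_def)
  have "aff_dim (TECSP V E) = int (dim (TECSP V E))"
    using zero by (intro aff_dim_zero hull_inc)
  also have "\<dots> \<le> int (dim (insert ?z (face e)))"
    using dim_subset[OF TECSP_subset_span[OF e bridge]] by simp
  also have "\<dots> \<le> int (dim (face e)) + 1"
    by (simp add: dim_insert)
  also have "int (dim (face e)) = aff_dim (face e)"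
    using zero by (intro aff_dim_zero[symmetric] hull_inc)
  finally show ?thesis
    using face_of_aff_dim_lt[OF convex_TECSP face_of_face[OF e] face_neq_TECSP[OF e]]
      face_of_face[OF e] zero by (auto simp: facet_of_def)
qed

section \<open>Necessity of the bridge condition\<close>

text \<open>If \<open>b\<close> is a bridge of \<open>G[S]\<close> splitting \<open>S\<close> into \<open>S - Y\<close> and \<open>Y\<close>, then the inequality is the sum of the
  valid inequalities given by \<open>e\<close> in \<open>\<delta>(S - Y)\<close> and by \<open>b\<close> in \<open>\<delta>(Y)\<close>.
  Unless \<open>b\<close> is coparallel to an edge of the cut, the second one defines a larger proper face.\<close>

lemma bridge_coparallel_if_facet:
  assumes e: "e \<in> D" and facet: "face e facet_of TECSP V E" and b: "ES \<inter> delta E T = {b}"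
  shows "\<exists>g\<in>D. \<exists>T'. delta E T' = {b, g}"
proof (rule ccontr)
  assume contra: "\<not> ?thesis"
  obtain Y where Y: "Y \<subseteq> S" "ES \<inter> delta E Y = {b}" "e \<notin> delta E Y"
    using normalized_cut[OF e, of T] b by metis
  have bE: "b \<in> E" "b \<notin> D" using b ES_subset ES_disjoint by auto
  define D2 where "D2 = delta E Y \<inter> D"
  have "c \<notin> delta E Y" if "c \<in> induced_edges E (V - S)" for c
  proof -
    have "c \<inter> Y = {}" using that Y(1) by (auto simp: induced_edges_def)
    then show ?thesis by (simp add: delta_def)
  qed
  then have dY: "delta E Y = insert b D2"
    unfolding D2_def using Y(2) edge_cases delta_subset[of E Y] by blast
  have dS1: "delta E (sym_diff S Y) = insert b (D - D2)"
    unfolding delta_sd dY using bE by (auto simp: D2_def)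
  have D2: "D2 \<subseteq> D" "e \<notin> D2" "b \<notin> D2" using Y(3) bE by (auto simp: D2_def)
  \<comment> \<open>If \<open>D2\<close> were \<open>{f}\<close> or \<open>D - D2\<close> were
    \<open>{e}\<close>, then \<open>b\<close> would form a 2-cut with that edge. So
    \<open>D2\<close> has two edges, and some \<open>g\<close> other than \<open>e\<close> lies
    outside it.\<close>
  have "D2 \<noteq> {}" using dY delta_neq[of Y b] by auto
  then obtain f where f: "f \<in> D2" by auto
  have "D2 \<noteq> {f}" using dY contra f D2 by blast
  then have "D2 - {f} \<noteq> {}" using f by auto
  have "D - D2 \<noteq> {e}" using dS1 contra e by metis
  then obtain g where g: "g \<in> D" "g \<notin> D2" "g \<noteq> e" using e D2 by blast
  define F' where "F' = TECSP V E \<inter> {x. cut_form (delta E Y) b x = 0}"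
  have bY: "b \<in> delta E Y" "delta E Y - {b} = D2" using dY D2 by auto
  have F': "F' face_of TECSP V E"
    unfolding F'_def by (rule cut_form_face[OF bY(1)])
  \<comment> \<open>The variable of \<open>b\<close> occurs with opposite signs and cancels.\<close>
  have sum: "cut_form D e x = cut_form (delta E (sym_diff S Y)) e x + cut_form (delta E Y) b x" for x
  proof -
    have "delta E (sym_diff S Y) - {e} = insert b (D - {e} - D2)" using dS1 e bE by auto
    moreover have "(\<Sum>f\<in>D - {e}. x $ f) = (\<Sum>f\<in>D - {e} - D2. x $ f) + (\<Sum>f\<in>D2. x $ f)"
      using D2 by (intro sum.subset_diff) auto
    ultimately show ?thesis
      using bE by (simp add: cut_form_def bY(2))
  qed
  have "face e \<subseteq> F'"
  proof
    fix x assume x: "x \<in> face e"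
    then have xP: "x \<in> TECSP V E" "cut_form D e x = 0" by (auto simp: face_def)
    have "e \<in> delta E (sym_diff S Y)" unfolding dS1 using e D2 by simp
    from cut_form_valid[OF this xP(1)] cut_form_valid[OF bY(1) xP(1)]
    show "x \<in> F'" using sum[of x] xP by (simp add: F'_def)
  qed
  have "F' \<noteq> TECSP V E"
  proof -
    have "card D2 \<noteq> 1" "card D2 \<noteq> 0"
      using \<open>D2 \<noteq> {f}\<close> f by (auto simp: card_1_singleton_iff)
    moreover have "E \<inter> D2 = D2" using D2 cut_subset by auto
    ultimately have "cut_form (delta E Y) b (incidence E) \<noteq> 0"
      using bE by (simp add: cut_form_incidence bY(2))
    then have "incidence E \<notin> F'" by (simp add: F'_def)
    then show ?thesis
      using incidence_in_TECSP[OF two_edge_connected_edges_self] by metis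
  qed
  then have "aff_dim F' < aff_dim (TECSP V E)"
    using F' face_of_aff_dim_lt convex_TECSP by blast
  moreover have "aff_dim (face e) < aff_dim F'" if "face e \<noteq> F'"
  proof -
    have "face e face_of F'"
      using face_of_subset[OF face_of_face[OF e] \<open>face e \<subseteq> F'\<close>] by (auto simp: F'_def)
    then show ?thesis using face_of_aff_dim_lt face_of_imp_convex[OF F'] convex_TECSP that by blast
  qed
  \<comment> \<open>There is no room for a dimension strictly between that of a facet and that of
    the polytope.\<close>
  ultimately have eq: "face e = F'"
    using facet by (fastforce simp: facet_of_def)
  \<comment> \<open>A point of \<open>F'\<close> off the face: a 2-edge-connected subgraph through
    \<open>f\<close> that avoids all cut edges but \<open>f\<close> and \<open>g\<close> must use
    \<open>g\<close> because of \<open>D\<close> and \<open>b\<close> because of the cut of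
    \<open>Y\<close>.\<close>
  let ?X = "pair_subgraph f g"
  have X: "?X \<subseteq> E" "?X \<inter> D \<subseteq> {f, g}" by (auto simp: pair_subgraph_def)
  obtain \<A> where A: "\<Union>\<A> = bridgeless_part ?X" "\<And>H. H \<in> \<A> \<Longrightarrow> two_edge_connected_edges V E H"
    using bridgeless_part_decomposition[OF X(1)] by metis
  have "f \<in> bridgeless_part ?X"
    using pair_subgraph_bridgeless f g D2 by blast
  then obtain H where H: "H \<in> \<A>" "f \<in> H" using A(1) by blast
  have HX: "H \<subseteq> ?X" using A(1) H(1) bridgeless_part_subset[of ?X] by blast
  note cutH = two_edge_connected_edges_cut(2)[OF A(2)[OF H(1)]]
  have "f \<in> D" using f D2 by auto
  then have "H \<inter> D = {f, g}" using cutH[of S f] HX X(2) H(2) by blast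
  moreover from this have "H \<inter> D2 = {f}" using f g D2 by blast
  moreover from this have "b \<in> H" using cutH[of Y f] unfolding dY by blast
  ultimately have "cut_form (delta E Y) b (incidence H) = 0" "e \<notin> H" "H \<inter> (D - {e}) = {f, g}"
    using D2 e f g by (auto simp: cut_form_incidence bY(2))
  then have "incidence H \<in> F'" "cut_form D e (incidence H) < 0"
    using incidence_in_TECSP[OF A(2)[OF H(1)]] by (auto simp: F'_def cut_form_incidence card_gt_0_iff)
  then show False using eq by (auto simp: face_def)
qed

end

section \<open>The equivalence, with bridges and classes translated into cuts\<close>

theorem mainTheorem7:
  fixes V :: "'v::finite set" and E :: "'v set set" and S :: "'v set" and e :: "'v set"
  assumes "simple_graph V E"
    and "two_edge_connected V E"
    and "{} \<subset> S" and "S \<subset> V"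
    and "minimal_cut V E (delta E S)"
    and "card (delta E S) \<ge> 3"
    and "e \<in> delta E S"
  shows "defines_facet (TECSP V E) (\<lambda>x. x $ e - (\<Sum>f\<in>delta E S - {e}. x $ f)) 0
    \<longleftrightarrow> (\<forall>b. is_bridge S (induced_edges E S) b \<or> is_bridge (V - S) (induced_edges E (V - S)) b
           \<longrightarrow> (\<exists>C f. coparallel_class V E C \<and> f \<in> delta E S \<and> b \<in> C \<and> f \<in> C))"
    (is "_ \<longleftrightarrow> ?bridges")
proof -
  interpret minimal_cut_graph V E S
    using assms by unfold_locales
  interpret complement: minimal_cut_graph V E "V - S"
    by (rule complement)
  have facet_iff: "defines_facet (TECSP V E) (\<lambda>x. x $ e - (\<Sum>f\<in>D - {e}. x $ f)) 0
      \<longleftrightarrow> face e facet_of TECSP V E"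
    using cut_form_valid[OF assms(7)] by (auto simp: defines_facet_def face_def cut_form_def)
  have class_iff: "(\<exists>C f. coparallel_class V E C \<and> f \<in> D \<and> b \<in> C \<and> f \<in> C)
      \<longleftrightarrow> (\<exists>f\<in>D. \<exists>T. delta E T = {b, f})"
    if b: "b \<in> ES \<or> b \<in> induced_edges E (V - S)" for b
  proof -
    \<comment> \<open>Makes \<open>b\<close> different from the cut edge \<open>f\<close>, so that a
      common class means a 2-cut.\<close>
    have "b \<notin> D"
      using b ES_disjoint complement.ES_disjoint unfolding delta_complement by auto
    then have "(\<exists>C. coparallel_class V E C \<and> b \<in> C \<and> f \<in> C) \<longleftrightarrow> (\<exists>T. delta E T = {b, f})"
      if "f \<in> D" for f
      using that by (intro common_coparallel_class_iff) auto
    then show ?thesis by (metis (no_types, lifting))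
  qed
  have "?bridges \<longleftrightarrow> (\<forall>b. is_bridge S ES b \<or> is_bridge (V - S) (induced_edges E (V - S)) b
      \<longrightarrow> (\<exists>f\<in>D. \<exists>T'. delta E T' = {b, f}))"
    by (intro iff_allI imp_cong refl class_iff) (auto simp: is_bridge_def)
  also have "\<dots> \<longleftrightarrow> (\<forall>b T. ES \<inter> delta E T = {b} \<or> induced_edges E (V - S) \<inter> delta E T = {b}
      \<longrightarrow> (\<exists>f\<in>D. \<exists>T'. delta E T' = {b, f}))"
    by (simp only: is_bridge_induced_iff ex_disj_distrib[symmetric] all_simps)
  also have "\<dots> \<longleftrightarrow> face e facet_of TECSP V E"
  proof
    assume facet: "face e facet_of TECSP V E"
    then show "\<forall>b T. ES \<inter> delta E T = {b} \<or> induced_edges E (V - S) \<inter> delta E T = {b}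
      \<longrightarrow> (\<exists>f\<in>D. \<exists>T'. delta E T' = {b, f})"
      by (intro allI impI, elim disjE)
        (rule bridge_coparallel_if_facet[OF assms(7) facet]
          complement.bridge_coparallel_if_facet[unfolded delta_complement face_complement, OF assms(7) facet];
         assumption)+
  next
    assume *: "\<forall>b T. ES \<inter> delta E T = {b} \<or> induced_edges E (V - S) \<inter> delta E T = {b}
      \<longrightarrow> (\<exists>f\<in>D. \<exists>T'. delta E T' = {b, f})"
    show "face e facet_of TECSP V E"
      by (rule face_facet[OF assms(7)], rule *[rule_format])
  qed
  finally show ?thesis unfolding facet_iff by (rule sym)
qed

end
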